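(* Let $B$ be a standard Brownian motion, $\beta>0$, and $$\Gamma_t=\frac{e^{B_t-t/2}}{1+\beta\int_0^te^{B_s-s/2}\,ds}.$$ Let $R$ be a hyperbolic Bessel process with parameter $\alpha=-1$, i.e. a diffusion solving $dR_t=dW_t-\tfrac12\coth(R_t)\,dt$ with $W$ a standard Brownian motion. Then for every $\lambda\ge0$ and $t\ge0$, $$\mathbb{E}e^{-\lambda\Gamma_t}=\mathbb{E}e^{-\beta(\cosh(R_t)-1)},$$ where the initial value of $R$ satisfies $\cosh(R_0)=\frac{\lambda}{\beta}+1$.
   Context: A hyperbolic Bessel process with parameter $\alpha\in\mathbb{R}$ is the diffusion with generator $\frac12\frac{d^2}{dx^2}+(\alpha+\frac12)\coth(x)\frac{d}{dx}$, i.e. solving $dR_t=dW_t+(\alpha+\frac12)\coth(R_t)\,dt$. *)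

theory Defs
  imports "HOL-Probability.Probability"
begin

definition brownian_motion :: "'a measure \<Rightarrow> (real \<Rightarrow> 'a \<Rightarrow> real) \<Rightarrow> bool" where
  "brownian_motion M B \<longleftrightarrow>
     prob_space M \<and>
     (\<forall>t\<ge>0. B t \<in> borel_measurable M) \<and>
     (\<forall>\<omega>\<in>space M. B 0 \<omega> = 0) \<and>
     (\<forall>\<omega>\<in>space M. continuous_on {0..} (\<lambda>t. B t \<omega>)) \<and>
     (\<forall>s t. 0 \<le> s \<and> s < t \<longrightarrow>
        distributed M lborel (\<lambda>\<omega>. B t \<omega> - B s \<omega>) (normal_density 0 (sqrt (t - s)))) \<and>
     (\<forall>ts::real list. sorted ts \<and> (\<forall>x\<in>set ts. 0 \<le> x) \<longrightarrow>
        prob_space.indep_vars M (\<lambda>_. borel)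
          (\<lambda>i \<omega>. B (ts ! Suc i) \<omega> - B (ts ! i) \<omega>) {..<length ts - 1})"

definition martingale :: "'a measure \<Rightarrow> (real \<Rightarrow> 'a measure) \<Rightarrow> (real \<Rightarrow> 'a \<Rightarrow> real) \<Rightarrow> bool" where
  "martingale M F X \<longleftrightarrow>
     (\<forall>t\<ge>0. X t \<in> borel_measurable (F t) \<and> integrable M (X t)) \<and>
     (\<forall>s t. 0 \<le> s \<and> s \<le> t \<longrightarrow> (AE \<omega> in M. real_cond_exp M (F s) (X t) \<omega> = X s \<omega>))"

text \<open>Generator of the hyperbolic Bessel process with parameter \<alpha>:
  (1/2) f'' + (\<alpha> + 1/2) coth(x) f'. At x = 0 (for even C^2 test functions, where f'(0) = 0)
  coth(x) f'(x) is replaced by its limit f''(0).\<close>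
definition hyp_bessel_gen :: "real \<Rightarrow> (real \<Rightarrow> real) \<Rightarrow> real \<Rightarrow> real" where
  "hyp_bessel_gen \<alpha> f x =
     1/2 * deriv (deriv f) x +
     (\<alpha> + 1/2) * (if x = 0 then deriv (deriv f) 0 else cosh x / sinh x * deriv f x)"

definition hb_test_fun :: "(real \<Rightarrow> real) \<Rightarrow> bool" where
  "hb_test_fun f \<longleftrightarrow>
     (\<forall>x. f (-x) = f x) \<and>
     (\<forall>x. f differentiable (at x)) \<and>
     (\<forall>x. deriv f differentiable (at x)) \<and>
     continuous_on UNIV (deriv (deriv f)) \<and>
     (\<exists>K. \<forall>x. K < \<bar>x\<bar> \<longrightarrow> f x = 0)"

definition hyp_bessel_process ::
  "real \<Rightarrow> 'a measure \<Rightarrow> (real \<Rightarrow> 'a measure) \<Rightarrow> real \<Rightarrow> (real \<Rightarrow> 'a \<Rightarrow> real) \<Rightarrow> bool" where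
  "hyp_bessel_process \<alpha> M F r0 R \<longleftrightarrow>
     prob_space M \<and>
     filtration (space M) F \<and>
     (\<forall>t. subalgebra M (F t)) \<and>
     (\<forall>t\<ge>0. R t \<in> borel_measurable (F t)) \<and>
     (\<forall>\<omega>\<in>space M. R 0 \<omega> = r0) \<and>
     (\<forall>\<omega>\<in>space M. \<forall>t\<ge>0. 0 \<le> R t \<omega>) \<and>
     (\<forall>\<omega>\<in>space M. continuous_on {0..} (\<lambda>t. R t \<omega>)) \<and>
     (\<forall>f. hb_test_fun f \<longrightarrow>
        martingale M F (\<lambda>t \<omega>. f (R t \<omega>) - f (R 0 \<omega>)
                              - integral {0..t} (\<lambda>s. hyp_bessel_gen \<alpha> f (R s \<omega>))))"

end

theory Submission
  imports Defs
begin

text \<open>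
  The process $Y = \cosh R - 1$ has generator $\frac12 (y^2 + 2y) \partial_y^2$, while $\Gamma$ has generator
  $\frac12 x^2 \partial_x^2 - \beta x^2 \partial_x$. Both act in the same way on $e^{-\beta x y}$, so
  $E e^{-\beta y \Gamma_t}$ (started from $\Gamma_0 = 1$) and $E e^{-\beta Y_t}$ (started from $Y_0 = y$) agree.

  Stochastic calculus is avoided on the Brownian side: replacing the integral in $\Gamma$ by a left
  Riemann sum of mesh $h$ turns $\Gamma$ into a Markov chain $X_{k+1} = \frac{X_k}{1 + \beta h X_k} (1 + m_k)$
  driven by the independent increments $1 + m_k = e^{\Delta B - h/2}$. With $v(s, x) = E e^{-\beta x Y_s}$,
  each increment of $k \mapsto E\, v(t - kh, X_k)$ is $O(h^{3/2})$: a Taylor expansion in $m_k$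
  describes the step of the chain, and Dynkin's formula, applied twice, the step of $Y$.
  Hence the endpoints $v(t, 1)$ and $E\, v(0, X_n)$ differ by $O(h^{1/2})$, and the Riemann sums converge pathwise.
\<close>

subsection \<open>Riemann sums and elementary estimates\<close>

text \<open>On exp(-\<beta>xy) both generators act as multiplication by \<beta>^2 x^2 y^2 / 2 +
  \<beta>^2 x^2 y. Two obstacles shape the proof. The martingale problem admits only even C^2
  functions of R with compact support, whereas exponentials in y have full support and the
  coefficient y^2 + 2y grows. And no Markov property of R is assumed, so only one-time laws of Y and
  expectations of time integrals enter, the latter evaluated through Riemann sums. Errors have to be
  uniform in the unbounded Y; this works because the derivatives of the exponential occur as w^k
  exp(-w) with w = \<beta>xy, which is at most k!. The chain alternates the exact flow x / (1 +
  \<beta>hx) of x' = -\<beta>x^2 with a factor of mean one. Hence its state at grid time u is at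
  most exp(B_u - u/2), and error constants that are quadratic in the state can be averaged. The
  order h^(3/2) of a step is the size of E|m|^3; over n = t/h steps this leaves h^(1/2).\<close>

lemma integral_equidistant_sum:
  fixes f :: "real \<Rightarrow> real"
  assumes cont: "continuous_on {a..a + real n * h} f" and h: "h \<ge> 0"
  shows "integral {a..a + real n * h} f = (\<Sum>k<n. integral {a + real k * h..a + real (Suc k) * h} f)"
  using cont
proof (induction n)
  case 0
  then show ?case by simp
next
  case (Suc n)
  have le: "a \<le> a + real n * h" "a + real n * h \<le> a + real (Suc n) * h"
    using h by (auto simp: algebra_simps)
  have "integral {a..a + real (Suc n) * h} f =
      integral {a..a + real n * h} f + integral {a + real n * h..a + real (Suc n) * h} f"
    using Suc.prems le by (intro Henstock_Kurzweil_Integration.integral_combine[symmetric] integrable_continuous_interval) auto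
  moreover have "continuous_on {a..a + real n * h} f"
    using le by (intro continuous_on_subset[OF Suc.prems]) auto
  ultimately show ?case using Suc.IH by simp
qed

text \<open>Uniform continuity bounds the error on each cell by \<epsilon>h. It serves twice: for
  the pathwise integral in \<Gamma>, and for the time integral in Dynkin's formula, where it
  replaces an exchange of expectation and integral.\<close>

lemma riemann_sum_tendsto:
  fixes f :: "real \<Rightarrow> real"
  assumes cont: "continuous_on {a..a + l} f" and l: "l \<ge> 0"
  shows "(\<lambda>n. l / real n * (\<Sum>k<n. f (a + real k * (l / real n)))) \<longlonglongrightarrow> integral {a..a + l} f"
proof (rule LIMSEQ_I)
  fix e :: real assume e: "e > 0"
  \<comment> \<open>The summand 1 keeps \<epsilon> well defined for l = 0; the total error
    \<epsilon>l stays below e.\<close>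
  define \<epsilon> where "\<epsilon> = e / (2 * (l + 1))"
  have \<epsilon>: "\<epsilon> > 0" using e l by (simp add: \<epsilon>_def)
  have "uniformly_continuous_on {a..a + l} f"
    using cont by (intro compact_uniformly_continuous) auto
  then obtain d where d: "d > 0" and
    fd: "\<And>x y. x \<in> {a..a + l} \<Longrightarrow> y \<in> {a..a + l} \<Longrightarrow> \<bar>y - x\<bar> < d \<Longrightarrow> \<bar>f y - f x\<bar> < \<epsilon>"
    using \<epsilon> unfolding uniformly_continuous_on_def dist_real_def by metis
  obtain m :: nat where m: "real m > l / d" using reals_Archimedean2 by blast
  show "\<exists>no. \<forall>n\<ge>no. norm (l / real n * (\<Sum>k<n. f (a + real k * (l / real n))) - integral {a..a + l} f) < e"
  proof (intro exI allI impI)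
    fix n assume n: "n \<ge> Suc m"
    define h where "h = l / real n"
    have n0: "real n > 0" using n by simp
    have h0: "h \<ge> 0" and nh: "real n * h = l" using n0 l by (auto simp: h_def)
    have "l / d < real n" using m n by linarith
    then have hd: "h < d" using d n0 by (simp add: h_def field_simps)
    have sub: "{a + real k * h..a + real (Suc k) * h} \<subseteq> {a..a + l}" if "k < n" for k
    proof -
      have "real (Suc k) * h \<le> real n * h" using that h0 by (intro mult_right_mono) auto
      then show ?thesis using h0 nh by auto
    qed
    have piece: "\<bar>integral {a + real k * h..a + real (Suc k) * h} f - h * f (a + real k * h)\<bar> \<le> \<epsilon> * h"
      if k: "k < n" for k
    proof -
      let ?I = "{a + real k * h..a + real (Suc k) * h}"
      have c: "continuous_on ?I f" using cont sub[OF k] by (rule continuous_on_subset)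
      have "integral ?I (\<lambda>x. f x - f (a + real k * h)) = integral ?I f - h * f (a + real k * h)"
        using h0 c by (subst Henstock_Kurzweil_Integration.integral_diff)
           (auto intro!: integrable_continuous_interval simp: algebra_simps)
      moreover have "norm (integral ?I (\<lambda>x. f x - f (a + real k * h))) \<le> \<epsilon> * ((a + real (Suc k) * h) - (a + real k * h))"
      proof (rule integral_bound)
        show "a + real k * h \<le> a + real (Suc k) * h" using h0 by (simp add: algebra_simps)
        show "continuous_on ?I (\<lambda>x. f x - f (a + real k * h))" using c by (intro continuous_intros)
        fix x assume x: "x \<in> ?I"
        have "a + real k * h \<in> {a..a + l}" using sub[OF k] h0 by (auto simp: algebra_simps)
        moreover have "\<bar>x - (a + real k * h)\<bar> < d" using x hd by (auto simp: algebra_simps)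
        ultimately show "norm (f x - f (a + real k * h)) \<le> \<epsilon>"
          using fd x sub[OF k] by (fastforce intro: less_imp_le)
      qed
      ultimately show ?thesis by (simp add: algebra_simps)
    qed
    have "integral {a..a + l} f = (\<Sum>k<n. integral {a + real k * h..a + real (Suc k) * h} f)"
      using integral_equidistant_sum[of a n h f] cont h0 nh by simp
    then have "\<bar>integral {a..a + l} f - h * (\<Sum>k<n. f (a + real k * h))\<bar> =
        \<bar>\<Sum>k<n. integral {a + real k * h..a + real (Suc k) * h} f - h * f (a + real k * h)\<bar>"
      by (simp add: sum_subtractf sum_distrib_left)
    also have "\<dots> \<le> (\<Sum>k<n. \<epsilon> * h)"
      by (rule order_trans[OF sum_abs]) (intro sum_mono piece, simp)
    also have "\<dots> = \<epsilon> * l" using nh by simp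
    also have "\<dots> < e"
    proof -
      have "0 < e * l + e * 2" using e l by (intro add_nonneg_pos) auto
      then show ?thesis using l by (simp add: \<epsilon>_def field_simps)
    qed
    finally show "norm (l / real n * (\<Sum>k<n. f (a + real k * (l / real n))) - integral {a..a + l} f) < e"
      by (simp add: h_def abs_minus_commute)
  qed
qed

section \<open>Bounds and expansions of exp(-w), uniform in w\<close>

text \<open>The constants are factorials: the single term w^k / k! of the exponential series is at
  most exp w.\<close>

lemma exp_neg_bounds:
  fixes w :: real
  assumes w: "w \<ge> 0"
  shows "w * exp (-w) \<le> 1" "w^2 * exp (-w) \<le> 2" "w^3 * exp (-w) \<le> 6" "w^4 * exp (-w) \<le> 24"
proof -
  have *: "w ^ k * exp (-w) \<le> fact k" for k
  proof -
    have "w ^ k / fact k \<le> exp w"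
    proof -
      have s: "(\<lambda>n. w ^ n /\<^sub>R fact n) sums exp w" by (rule exp_converges)
      have "(\<Sum>n\<in>{k}. w ^ n /\<^sub>R fact n) \<le> (\<Sum>n. w ^ n /\<^sub>R fact n)"
        using s w by (intro sum_le_suminf) (auto simp: sums_iff)
      then show ?thesis using s by (simp add: sums_iff divide_inverse mult.commute)
    qed
    then show ?thesis by (simp add: exp_minus field_simps)
  qed
  show "w * exp (-w) \<le> 1" "w^2 * exp (-w) \<le> 2" "w^3 * exp (-w) \<le> 6" "w^4 * exp (-w) \<le> 24"
    using *[of 1] *[of 2] *[of 3] *[of 4] by (auto simp: fact_numeral)
qed

text \<open>In the Lagrange remainder the intermediate point lies between 0 and -u, so its
  exponential is at most max 1 (exp (-u)). The sign of u decides which one-sided Maclaurin theorem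
  applies.\<close>

lemma exp_taylor3_bound:
  fixes u :: real
  shows "\<bar>exp (-u) - (1 - u + u^2 / 2)\<bar> \<le> \<bar>u\<bar>^3 / 6 * max 1 (exp (-u))"
proof -
  have *: "\<bar>exp (-u) - (1 - u + u^2 / 2)\<bar> \<le> \<bar>u\<bar>^3 / 6 * max 1 (exp (-u))"
    if e: "exp (-u) = (\<Sum>m<3. exp 0 / fact m * (-u) ^ m) + exp t / fact 3 * (-u) ^ 3"
      and t: "t \<le> max 0 (-u)" for t
  proof -
    have "exp (-u) - (1 - u + u^2 / 2) = exp t / 6 * (-u) ^ 3"
      using e by (simp add: eval_nat_numeral field_simps)
    then have "\<bar>exp (-u) - (1 - u + u^2 / 2)\<bar> = \<bar>u\<bar>^3 / 6 * exp t"
      by (simp add: abs_mult power_abs)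
    moreover have "exp t \<le> max 1 (exp (-u))"
      using t by (smt (verit) exp_le_cancel_iff exp_zero)
    ultimately show ?thesis by (simp add: mult_left_mono)
  qed
  consider "u = 0" | "u > 0" | "u < 0" by linarith
  then show ?thesis
  proof cases
    case 1
    then show ?thesis by simp
  next
    case 2
    obtain t where "-u < t" "t < 0"
      and "exp (-u) = (\<Sum>m<3. exp 0 / fact m * (-u) ^ m) + exp t / fact 3 * (-u) ^ 3"
      using Maclaurin_minus[of "-u" 3 "\<lambda>_. exp" exp] 2 by (auto intro!: derivative_eq_intros)
    then show ?thesis by (intro *[of t]) auto
  next
    case 3
    obtain t where "0 < t" "t < -u"
      and "exp (-u) = (\<Sum>m<3. exp 0 / fact m * (-u) ^ m) + exp t / fact 3 * (-u) ^ 3"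
      using Maclaurin[of "-u" 3 "\<lambda>_. exp" exp] 3 by (auto intro!: derivative_eq_intros)
    then show ?thesis by (intro *[of t]) auto
  qed
qed

text \<open>The point is the uniformity in $a$, that is, in the unbounded variable $Y$.\<close>
lemma exp_multiplicative_taylor:
  fixes a m :: real
  assumes a: "a \<ge> 0" and m: "m > -1"
  shows "\<bar>exp (- a * (1 + m)) - (exp (-a) - m * (a * exp (-a)) + m^2 / 2 * (a^2 * exp (-a)))\<bar> \<le> 24 * \<bar>m\<bar>^3"
proof -
  let ?L = "exp (- a * (1 + m)) - (exp (-a) - m * (a * exp (-a)) + m^2 / 2 * (a^2 * exp (-a)))"
  have L: "?L = exp (-a) * (exp (-(a * m)) - (1 - a * m + (a * m)^2 / 2))"
    by (simp add: algebra_simps power_mult_distrib flip: exp_add)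
  show ?thesis
  proof (cases "m \<ge> -1/2")
    case True
    have "\<bar>?L\<bar> \<le> exp (-a) * (\<bar>a * m\<bar>^3 / 6 * max 1 (exp (-(a * m))))"
      unfolding L abs_mult[of "exp (-a)"] using exp_taylor3_bound[of "a * m"]
      by (simp only: abs_exp_cancel) (intro mult_left_mono, auto)
    also have "\<dots> = \<bar>m\<bar>^3 / 6 * (a^3 * (exp (-a) * max 1 (exp (-(a * m)))))"
      using a by (simp add: abs_mult power_mult_distrib)
    also have "exp (-a) * max 1 (exp (-(a * m))) \<le> exp (-(a / 2))"
    proof -
      have "a * (-1/2) \<le> a * m" using True a by (rule mult_left_mono)
      then show ?thesis using a by (auto simp: max_def simp flip: exp_add)
    qed
    also have "a^3 * exp (-(a / 2)) = 8 * ((a / 2)^3 * exp (-(a / 2)))"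
      by (simp add: power_divide)
    also have "\<dots> \<le> 8 * 6" using exp_neg_bounds(3)[of "a / 2"] a by linarith
    finally have "\<bar>?L\<bar> \<le> \<bar>m\<bar>^3 / 6 * (8 * 6)" using a by (simp add: mult_left_mono)
    moreover have "0 \<le> \<bar>m\<bar>^3" by simp
    ultimately show ?thesis by linarith
  next
    case False
    have e1: "0 \<le> exp (- a * (1 + m)) \<and> exp (- a * (1 + m)) \<le> 1"
      using a m by (simp add: mult_nonneg_nonneg)
    have mb: "0 \<le> -m" "-m \<le> 1" "0 \<le> m^2" "m^2 \<le> 1"
      using False m by (auto simp: power2_le_iff_abs_le abs_le_iff power_le_one_iff abs_square_le_1)
    have A: "0 \<le> a * exp (-a)" "a * exp (-a) \<le> 1" "0 \<le> a^2 * exp (-a)" "a^2 * exp (-a) \<le> 2"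
      "0 \<le> exp (-a)" "exp (-a) \<le> 1" using a exp_neg_bounds[OF a] by auto
    have "0 \<le> (-m) * (a * exp (-a))" "(-m) * (a * exp (-a)) \<le> 1"
      using mult_nonneg_nonneg[OF mb(1) A(1)] mult_le_one[OF mb(2) A(1,2)] by auto
    moreover have "0 \<le> m^2 * (a^2 * exp (-a) / 2)" "m^2 * (a^2 * exp (-a) / 2) \<le> 1"
      using mult_le_one[OF mb(4), of "a^2 * exp (-a) / 2"] mult_nonneg_nonneg[OF mb(3), of "a^2 * exp (-a) / 2"] A
      by linarith+
    moreover have "m^2 / 2 * (a^2 * exp (-a)) = m^2 * (a^2 * exp (-a) / 2)" by simp
    ultimately have "\<bar>?L\<bar> \<le> 3" using e1 A(5,6) by linarith
    also have "3 \<le> 24 * \<bar>m\<bar>^3"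
    proof -
      have "(1/2)^3 \<le> \<bar>m\<bar>^3" using False by (intro power_mono) auto
      then show ?thesis by (simp add: power_divide)
    qed
    finally show ?thesis .
  qed
qed

text \<open>The derivative is written through a = w / (1 + t) itself, so that differentiating
  functions of a again gives polynomials in a times exp(-a), over powers of 1 + t.\<close>

lemma deriv_inverse_scaling:
  fixes t w :: real
  assumes "1 + t \<noteq> 0"
  shows "((\<lambda>t. w / (1 + t)) has_real_derivative - (w / (1 + t)) / (1 + t)) (at t)"
  using assms by (auto intro!: derivative_eq_intros)

text \<open>This is the deterministic half of a step of the chain, with w = \<beta>xy and \<eta> =
  \<beta>hx. The second derivative in \<eta> is (a^2 - 2a) exp(-a) / (1 + t)^2 with a = w / (1 + t),
  at most 4 in absolute value whatever w is.\<close>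

lemma exp_scaling_taylor:
  fixes w \<eta> :: real
  assumes w: "w \<ge> 0" and \<eta>: "\<eta> \<ge> 0"
  shows "\<bar>exp (-(w / (1 + \<eta>))) - exp (-w) - \<eta> * (w * exp (-w))\<bar> \<le> 2 * \<eta>^2"
proof (cases "\<eta> = 0")
  case True
  then show ?thesis by simp
next
  case False
  \<comment> \<open>The Maclaurin theorem takes a sequence of derivatives. Only the indices 0, 1, 2
    matter; all indices from 2 on receive the second derivative.\<close>
  define D where "D m t = (if m = 0 then exp (-(w / (1 + t))) else
      if m = 1 then w / (1 + t) / (1 + t) * exp (-(w / (1 + t)))
      else ((w / (1 + t))^2 - 2 * (w / (1 + t))) / (1 + t)^2 * exp (-(w / (1 + t))))" for m :: nat and t :: real
  have der: "\<forall>m t. m < 2 \<and> 0 \<le> t \<and> t \<le> \<eta> \<longrightarrow> DERIV (D m) t :> D (Suc m) t"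
  proof (intro allI impI, elim conjE)
    fix m :: nat and t :: real assume m: "m < 2" and t: "0 \<le> t" "t \<le> \<eta>"
    have nz: "1 + t \<noteq> 0" using t by simp
    note da = deriv_inverse_scaling[OF nz, of w]
    consider "m = 0" | "m = 1" using m by linarith
    then show "DERIV (D m) t :> D (Suc m) t"
    proof cases
      case 1
      have "((\<lambda>t. exp (-(w / (1 + t)))) has_real_derivative w / (1 + t) / (1 + t) * exp (-(w / (1 + t)))) (at t)"
        using DERIV_chain2[OF DERIV_exp DERIV_minus[OF da]] by (simp add: mult.commute)
      then show ?thesis using 1 by (simp add: D_def[abs_def])
    next
      case 2
      have alg: "(- a / q * q - a * 1) / (q * q) * e + a / q * (e * (a / q)) = (a^2 - 2 * a) / q^2 * e"
        if "q \<noteq> 0" for a q e :: real using that by (simp add: field_simps power2_eq_square)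
      have "((\<lambda>t. 1 + t) has_real_derivative 1) (at t)" by (auto intro!: derivative_eq_intros)
      from DERIV_mult[OF DERIV_divide[OF da this nz] DERIV_chain2[OF DERIV_exp DERIV_minus[OF da]]]
      have "((\<lambda>t. w / (1 + t) / (1 + t) * exp (-(w / (1 + t)))) has_real_derivative
          ((w / (1 + t))^2 - 2 * (w / (1 + t))) / (1 + t)^2 * exp (-(w / (1 + t)))) (at t)"
        by (rule DERIV_cong) (use alg[OF nz, of "w / (1 + t)" "exp (-(w / (1 + t)))"] in \<open>simp add: mult.commute\<close>)
      then show ?thesis using 2 by (simp add: D_def[abs_def])
    qed
  qed
  obtain t where t: "0 < t" "t < \<eta>" and
    e: "D 0 \<eta> = (\<Sum>m<2. D m 0 / fact m * \<eta> ^ m) + D 2 t / fact 2 * \<eta> ^ 2"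
    using Maclaurin[of \<eta> 2 D "D 0"] der \<eta> False by auto
  define a where "a = w / (1 + t)"
  have a: "a \<ge> 0" using w t by (simp add: a_def)
  have "exp (-(w / (1 + \<eta>))) - exp (-w) - \<eta> * (w * exp (-w)) = D 2 t / 2 * \<eta>^2"
    using e by (simp add: D_def eval_nat_numeral)
  also have "D 2 t = (a^2 * exp (-a) - 2 * (a * exp (-a))) / (1 + t)^2"
    by (simp add: D_def a_def left_diff_distrib)
  finally have "\<bar>exp (-(w / (1 + \<eta>))) - exp (-w) - \<eta> * (w * exp (-w))\<bar> =
      \<bar>a^2 * exp (-a) - 2 * (a * exp (-a))\<bar> / (1 + t)^2 / 2 * \<eta>^2"
    by (simp add: abs_mult)
  also have "\<dots> \<le> 4 / 2 * \<eta>^2"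
  proof (intro mult_right_mono divide_right_mono)
    have "\<bar>a^2 * exp (-a) - 2 * (a * exp (-a))\<bar> / (1 + t)^2 \<le> \<bar>a^2 * exp (-a) - 2 * (a * exp (-a))\<bar> / 1"
      using t by (intro divide_left_mono) auto
    also have "\<dots> \<le> 4"
      using exp_neg_bounds(1,2)[OF a] a by (simp add: abs_le_iff) (smt (verit) mult_nonneg_nonneg exp_ge_zero zero_le_power)
    finally show "\<bar>a^2 * exp (-a) - 2 * (a * exp (-a))\<bar> / (1 + t)^2 \<le> 4" .
  qed auto
  finally show ?thesis by simp
qed

text \<open>First order suffices here, since this term is later multiplied by the variance of the
  noise, itself of order h. The derivative in \<eta> is (a^3 - 2a^2) exp(-a) / (1 + t), and 10 = 6 +
  2 * 2.\<close>

lemma square_exp_scaling_bound: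
  fixes w \<eta> :: real
  assumes w: "w \<ge> 0" and \<eta>: "\<eta> \<ge> 0"
  shows "\<bar>(w / (1 + \<eta>))^2 * exp (-(w / (1 + \<eta>))) - w^2 * exp (-w)\<bar> \<le> 10 * \<eta>"
proof (cases "\<eta> = 0")
  case True
  then show ?thesis by simp
next
  case False
  let ?f = "\<lambda>t. (w / (1 + t))^2 * exp (-(w / (1 + t)))"
  let ?f' = "\<lambda>t. ((w / (1 + t))^3 - 2 * (w / (1 + t))^2) * exp (-(w / (1 + t))) / (1 + t)"
  have "\<exists>z>0. z < \<eta> \<and> ?f \<eta> - ?f 0 = (\<eta> - 0) * ?f' z"
  proof (rule MVT2)
    show "0 < \<eta>" using False \<eta> by simp
    fix t :: real assume "0 \<le> t" "t \<le> \<eta>"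
    then have nz: "1 + t \<noteq> 0" by simp
    note da = deriv_inverse_scaling[OF nz, of w]
    have alg: "2 * (a * (- a / q)) * e + e * (a / q) * a^2 = (a^3 - 2 * a^2) * e / q"
      if "q \<noteq> 0" for a q e :: real using that by (simp add: field_simps eval_nat_numeral)
    show "DERIV ?f t :> ?f' t"
      by (rule DERIV_cong[OF DERIV_mult[OF DERIV_power[OF da, of 2] DERIV_chain2[OF DERIV_exp DERIV_minus[OF da]]]])
         (use alg[OF nz, of "w / (1 + t)" "exp (-(w / (1 + t)))"] in \<open>simp add: mult_ac\<close>)
  qed
  then obtain z where z: "z > 0" and e: "?f \<eta> - ?f 0 = \<eta> * ?f' z" by auto
  define a where "a = w / (1 + z)"
  have a: "a \<ge> 0" using w z by (simp add: a_def)
  have "\<bar>?f' z\<bar> = \<bar>a^3 * exp (-a) - 2 * (a^2 * exp (-a))\<bar> / (1 + z)"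
    using z by (simp add: a_def algebra_simps)
  also have "\<dots> \<le> \<bar>a^3 * exp (-a) - 2 * (a^2 * exp (-a))\<bar> / 1"
    using z by (intro divide_left_mono) auto
  also have "\<dots> \<le> 10"
    using exp_neg_bounds(2,3)[OF a] a by (simp add: abs_le_iff) (smt (verit) mult_nonneg_nonneg exp_ge_zero zero_le_power)
  finally have "\<eta> * \<bar>?f' z\<bar> \<le> \<eta> * 10" using \<eta> by (intro mult_left_mono)
  then show ?thesis using e \<eta> by (simp add: abs_mult)
qed

subsection \<open>Dynkin's formula for the hyperbolic cosine of the process\<close>

text \<open>At the kink the difference quotient is at most |h|^(k+1). Used for the exponents 4 and
  3, it makes the fourth power of a positive part twice differentiable, which is the regularity
  demanded of test functions.\<close>

lemma DERIV_pos_part_power: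
  fixes u :: real
  shows "((\<lambda>u. (max 0 u) ^ Suc (Suc k)) has_real_derivative real (Suc (Suc k)) * (max 0 u) ^ Suc k) (at u)"
proof -
  consider "u > 0" | "u < 0" | "u = 0" by linarith
  then show ?thesis
  proof cases
    case 1
    have "((\<lambda>u. u ^ Suc (Suc k)) has_real_derivative real (Suc (Suc k)) * u ^ Suc k) (at u)"
      using DERIV_pow[of "Suc (Suc k)" u] by simp
    then show ?thesis
      using 1 by (subst DERIV_cong_ev[OF refl _ refl, where g="\<lambda>u. u ^ Suc (Suc k)"])
        (auto simp: max_def intro!: eventually_mono[OF eventually_nhds_in_open[of "{0<..}" u]])
  next
    case 2
    have "((\<lambda>u. 0) has_real_derivative 0) (at u)" by simp
    then show ?thesis
      using 2 by (subst DERIV_cong_ev[OF refl _ refl, where g="\<lambda>u. 0"])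
        (auto simp: max_def intro!: eventually_mono[OF eventually_nhds_in_open[of "{..<0}" u]])
  next
    case 3
    have "((\<lambda>h. (max 0 h) ^ Suc (Suc k) / h) \<longlongrightarrow> 0) (at (0::real))"
    proof (rule Lim_null_comparison)
      show "\<forall>\<^sub>F h in at (0::real). norm ((max 0 h) ^ Suc (Suc k) / h) \<le> \<bar>h\<bar> ^ Suc k"
        by (rule always_eventually) (auto simp: max_def mult_nonpos_nonneg)
      have "((\<lambda>h. \<bar>h\<bar> ^ Suc k) \<longlongrightarrow> \<bar>0\<bar> ^ Suc k) (at (0::real))"
        by (intro tendsto_intros)
      then show "((\<lambda>h. \<bar>h\<bar> ^ Suc k) \<longlongrightarrow> 0) (at (0::real))" by simp
    qed
    then show ?thesis using 3 by (simp add: DERIV_def)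
  qed
qed

text \<open>The substitution y = cosh x - 1 removes the singularity: f'' contains g' cosh x, and the
  drift -coth(x)/2 applied to f' = g' sinh x cancels exactly half of it, leaving sinh^2 x = y^2 + 2y
  in front of g''/2. At x = 0 the convention for the generator gives 0 on both sides. Evenness of
  the test function comes from that of cosh.\<close>

lemma hyp_bessel_cosh_test:
  fixes g g' g'' :: "real \<Rightarrow> real"
  assumes d1: "\<And>y. (g has_real_derivative g' y) (at y)"
    and d2: "\<And>y. (g' has_real_derivative g'' y) (at y)"
    and c2: "continuous_on UNIV g''"
  defines "f \<equiv> \<lambda>x. g (cosh x - 1)"
  shows "hyp_bessel_gen (-1) f x = ((cosh x - 1)^2 + 2 * (cosh x - 1)) / 2 * g'' (cosh x - 1)"
    and "(\<And>y. y \<ge> K \<Longrightarrow> g y = 0) \<Longrightarrow> hb_test_fun f"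
proof -
  have D1: "(f has_real_derivative g' (cosh x - 1) * sinh x) (at x)" for x
    unfolding f_def by (rule DERIV_chain2[OF d1]) (auto intro!: derivative_eq_intros)
  have e1: "deriv f = (\<lambda>x. g' (cosh x - 1) * sinh x)"
    using D1 by (auto intro!: DERIV_imp_deriv)
  have D2: "(deriv f has_real_derivative g'' (cosh x - 1) * (sinh x)^2 + g' (cosh x - 1) * cosh x) (at x)" for x
  proof -
    have "((\<lambda>x. g' (cosh x - 1)) has_real_derivative g'' (cosh x - 1) * sinh x) (at x)"
      by (rule DERIV_chain2[OF d2]) (auto intro!: derivative_eq_intros)
    moreover have "(sinh has_real_derivative cosh x) (at x)" by (auto intro!: derivative_eq_intros)
    ultimately have "((\<lambda>x. g' (cosh x - 1) * sinh x) has_real_derivative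
        g'' (cosh x - 1) * sinh x * sinh x + cosh x * g' (cosh x - 1)) (at x)"
      by (rule DERIV_mult)
    then     show ?thesis unfolding e1 by (simp add: power2_eq_square mult_ac)
  qed
  have e2: "deriv (deriv f) = (\<lambda>x. g'' (cosh x - 1) * (sinh x)^2 + g' (cosh x - 1) * cosh x)"
    using D2 by (auto intro!: DERIV_imp_deriv)
  have s: "(cosh x - 1)^2 + 2 * (cosh x - 1) = (sinh x)^2" for x :: real
    using cosh_square_eq[of x] by (simp add: power2_eq_square algebra_simps)
  show "hyp_bessel_gen (-1) f x = ((cosh x - 1)^2 + 2 * (cosh x - 1)) / 2 * g'' (cosh x - 1)"
    unfolding hyp_bessel_gen_def e2 s by (auto simp: e1 field_simps power2_eq_square)
  show "hb_test_fun f" if K: "\<And>y. y \<ge> K \<Longrightarrow> g y = 0"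
    unfolding hb_test_fun_def
  proof (intro conjI allI)
    show "f (-x) = f x" for x by (simp add: f_def)
    show "f differentiable (at x)" for x using D1 real_differentiable_def by blast
    show "deriv f differentiable (at x)" for x using D2 real_differentiable_def by blast
    have c1: "continuous_on UNIV g'"
      using d2 by (intro continuous_at_imp_continuous_on ballI) (blast intro: DERIV_isCont)
    show "continuous_on UNIV (deriv (deriv f))"
      unfolding e2 by (intro continuous_intros continuous_on_compose2[OF c2] continuous_on_compose2[OF c1]) auto
    show "\<exists>K. \<forall>x. K < \<bar>x\<bar> \<longrightarrow> f x = 0"
    proof (intro exI allI impI)
      \<comment> \<open>From 1 + |x| <= exp |x| <= 2 cosh x one gets cosh x - 1 >= (|x| - 1) / 2,
        which exceeds K beyond 2K + 1.\<close>
      fix x :: real assume x: "2 * K + 1 < \<bar>x\<bar>"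
      have "1 + \<bar>x\<bar> \<le> exp \<bar>x\<bar>" by (rule exp_ge_add_one_self)
      also have "exp \<bar>x\<bar> \<le> 2 * cosh \<bar>x\<bar>" by (simp add: cosh_def)
      finally have "K \<le> cosh x - 1" using x by simp
      then show "f x = 0" by (simp add: f_def K)
    qed
  qed
qed

text \<open>Functions to which the martingale problem for $y = \cosh x - 1$, with generator
  $\frac12 (y^2 + 2 y) g''(y)$, extends by truncation.\<close>
definition bounded_generator ::
    "real \<Rightarrow> (real \<Rightarrow> real) \<Rightarrow> (real \<Rightarrow> real) \<Rightarrow> (real \<Rightarrow> real) \<Rightarrow> bool" where
  "bounded_generator C g g' g'' \<longleftrightarrow>
     (\<forall>y. (g has_real_derivative g' y) (at y)) \<and>
     (\<forall>y. (g' has_real_derivative g'' y) (at y)) \<and>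
     continuous_on UNIV g'' \<and>
     (\<forall>y\<ge>0. \<bar>g y\<bar> \<le> C \<and> (1 + y) * \<bar>g' y\<bar> \<le> C \<and> (y^2 + 2 * y) * \<bar>g'' y\<bar> \<le> C)"

definition cosh_gen :: "(real \<Rightarrow> real) \<Rightarrow> real \<Rightarrow> real" where
  "cosh_gen g'' y = (y^2 + 2 * y) / 2 * g'' y"

text \<open>The cutoff $\max(0, 1 - y/q)^4$ is not constant near the origin, but its first two derivatives are
  $O(1/q)$ and $O(1/q^2)$, which is enough to compensate the quadratic coefficient.\<close>
lemma cutoff_bounds:
  fixes C y q p dg ddg :: real
  assumes y: "y \<ge> 0" and q: "q \<ge> 1"
    and b: "\<bar>p\<bar> \<le> C" "(1 + y) * \<bar>dg\<bar> \<le> C" "(y^2 + 2 * y) * \<bar>ddg\<bar> \<le> C"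
  defines "m \<equiv> max 0 (1 - y / q)"
  shows "\<bar>(y^2 + 2 * y) / 2 * (ddg * m ^ 4 + 2 * (dg * (- (4 / q) * m ^ 3)) + p * (12 / q^2 * m^2))\<bar> \<le> 27 * C"
proof (cases "y \<le> q")
  case True
  have m: "0 \<le> m" "m \<le> 1" using y q by (auto simp: m_def)
  have mp: "0 \<le> m ^ k" "m ^ k \<le> 1" for k using m by (auto intro: power_le_one)
  have z: "0 \<le> y^2 + 2 * y" using y by simp
  have C: "C \<ge> 0" using b(1) by linarith
  have z1: "(y^2 + 2 * y) / q \<le> 2 * (1 + y)"
  proof -
    have "y^2 \<le> y * q" using True y by (simp add: power2_eq_square mult_left_mono)
    moreover have "0 \<le> y * q" using y q by simp
    moreover have "2 * (1 + y) * q = 2 * q + 2 * (y * q)" by (simp add: algebra_simps)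
    ultimately have "y^2 + 2 * y \<le> 2 * (1 + y) * q" using True by linarith
    then show ?thesis using q by (simp add: divide_le_eq)
  qed
  have z2: "(y^2 + 2 * y) / q^2 \<le> 3"
  proof -
    have "y^2 \<le> q^2" using True y by (simp add: power_mono)
    moreover have "y * 1 \<le> q * q" using True y q by (intro mult_mono) auto
    ultimately have "y^2 + 2 * y \<le> 3 * q^2" by (simp add: power2_eq_square)
    then show ?thesis using q by (simp add: divide_le_eq)
  qed
  have T1: "\<bar>(y^2 + 2 * y) * ddg * m ^ 4\<bar> \<le> C"
  proof -
    have "\<bar>(y^2 + 2 * y) * ddg * m ^ 4\<bar> = ((y^2 + 2 * y) * \<bar>ddg\<bar>) * m ^ 4"
      using z mp[of 4] by (simp add: abs_mult)
    also have "\<dots> \<le> C * 1" using b(3) mp[of 4] C by (intro mult_mono) auto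
    finally show ?thesis by simp
  qed
  have T2: "\<bar>(y^2 + 2 * y) / q * dg * m ^ 3\<bar> \<le> 2 * C"
  proof -
    have "\<bar>(y^2 + 2 * y) / q * dg * m ^ 3\<bar> = ((y^2 + 2 * y) / q * \<bar>dg\<bar>) * m ^ 3"
      using z mp[of 3] q by (simp add: abs_mult)
    also have "\<dots> \<le> (2 * (1 + y) * \<bar>dg\<bar>) * 1" using z1 mp[of 3] y by (intro mult_mono) auto
    also have "\<dots> = 2 * ((1 + y) * \<bar>dg\<bar>)" by simp
    also have "\<dots> \<le> 2 * C" using b(2) by linarith
    finally show ?thesis .
  qed
  have T3: "\<bar>(y^2 + 2 * y) / q^2 * p * m ^ 2\<bar> \<le> 3 * C"
  proof -
    have "\<bar>(y^2 + 2 * y) / q^2 * p * m ^ 2\<bar> = ((y^2 + 2 * y) / q^2 * \<bar>p\<bar>) * m ^ 2"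
      using z mp[of 2] q by (simp add: abs_mult)
    also have "\<dots> \<le> (3 * C) * 1" using z2 mp[of 2] b(1) z C by (intro mult_mono) auto
    finally show ?thesis by simp
  qed
  \<comment> \<open>The three terms of the product rule contribute C/2, 4 * 2C and 6 * 3C, together
    below 27C.\<close>
  have "(y^2 + 2 * y) / 2 * (ddg * m ^ 4 + 2 * (dg * (- (4 / q) * m ^ 3)) + p * (12 / q^2 * m^2)) =
      ((y^2 + 2 * y) * ddg * m ^ 4) / 2 - 4 * ((y^2 + 2 * y) / q * dg * m ^ 3) + 6 * ((y^2 + 2 * y) / q^2 * p * m ^ 2)"
    by (simp add: field_simps)
  then show ?thesis using T1 T2 T3 C unfolding abs_le_iff by linarith
next
  case False
  then have "m = 0" using q by (auto simp: m_def)
  then show ?thesis using b(1) by simp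
qed

section \<open>From the martingale problem to Dynkin's formula\<close>

locale hyp_bessel_neg_one =
  fixes N :: "'b measure" and F :: "real \<Rightarrow> 'b measure" and R :: "real \<Rightarrow> 'b \<Rightarrow> real" and r0 :: real
  assumes hb: "hyp_bessel_process (-1) N F r0 R"
begin

definition Y :: "real \<Rightarrow> 'b \<Rightarrow> real" where "Y t \<omega> = cosh (R t \<omega>) - 1"

sublocale prob_space N using hb by (simp add: hyp_bessel_process_def)

lemma Y_nonneg: "Y t \<omega> \<ge> 0" by (simp add: Y_def cosh_real_ge_1)

lemma Y_zero: "\<omega> \<in> space N \<Longrightarrow> Y 0 \<omega> = cosh r0 - 1"
  using hb by (simp add: hyp_bessel_process_def Y_def)

lemma Y_measurable [measurable]:
  assumes "t \<ge> 0" shows "Y t \<in> borel_measurable N"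
proof -
  have "R t \<in> borel_measurable N"
    using hb assms measurable_from_subalg unfolding hyp_bessel_process_def by blast
  moreover have "cosh \<in> borel_measurable (borel :: real measure)"
    by (intro borel_measurable_continuous_onI continuous_intros)
  ultimately show ?thesis unfolding Y_def[abs_def] by measurable
qed

lemma Y_continuous: "\<omega> \<in> space N \<Longrightarrow> 0 \<le> s \<Longrightarrow> continuous_on {s..t} (\<lambda>r. Y r \<omega>)"
  using hb unfolding hyp_bessel_process_def Y_def
  by (intro continuous_intros) (rule continuous_on_subset[of "{0..}"], auto)

text \<open>A martingale has constant expectation. Pathwise the time integral equals g(Y_t) - g(Y_s)
  - (X_t - X_s), so its integrability is inherited from the martingale X and needs no joint
  measurability in time and \<omega>.\<close>

lemma dynkin_compact_support:
  fixes g g' g'' :: "real \<Rightarrow> real"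
  assumes d1: "\<And>y. (g has_real_derivative g' y) (at y)"
    and d2: "\<And>y. (g' has_real_derivative g'' y) (at y)"
    and c2: "continuous_on UNIV g''"
    and K: "\<And>y. y \<ge> K \<Longrightarrow> g y = 0"
    and st: "0 \<le> s" "s \<le> t"
  shows "integrable N (\<lambda>\<omega>. integral {s..t} (\<lambda>r. cosh_gen g'' (Y r \<omega>)))"
    and "expectation (\<lambda>\<omega>. g (Y t \<omega>)) - expectation (\<lambda>\<omega>. g (Y s \<omega>)) =
      expectation (\<lambda>\<omega>. integral {s..t} (\<lambda>r. cosh_gen g'' (Y r \<omega>)))"
proof -
  define X where "X t \<omega> = g (Y t \<omega>) - g (Y 0 \<omega>) - integral {0..t} (\<lambda>r. cosh_gen g'' (Y r \<omega>))" for t \<omega>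
  have "hb_test_fun (\<lambda>x. g (cosh x - 1))"
    using hyp_bessel_cosh_test(2)[OF d1 d2 c2 K] .
  then have "martingale N F (\<lambda>t \<omega>. g (cosh (R t \<omega>) - 1) - g (cosh (R 0 \<omega>) - 1)
        - integral {0..t} (\<lambda>s. hyp_bessel_gen (-1) (\<lambda>x. g (cosh x - 1)) (R s \<omega>)))"
    using hb unfolding hyp_bessel_process_def by blast
  then have mart: "martingale N F X"
    by (simp add: X_def[abs_def] Y_def cosh_gen_def hyp_bessel_cosh_test(1)[OF d1 d2 c2])
  have iX: "integrable N (X t)" "integrable N (X s)"
    using mart st by (auto simp: martingale_def)
  have "subalgebra N (F s)" using hb by (simp add: hyp_bessel_process_def)
  then interpret S: finite_measure_subalgebra N "F s"
    by unfold_locales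
  have "expectation (X s) = expectation (real_cond_exp N (F s) (X t))"
  proof (intro integral_cong_AE)
    have "AE \<omega> in N. real_cond_exp N (F s) (X t) \<omega> = X s \<omega>" using mart st by (auto simp: martingale_def)
    then show "AE \<omega> in N. X s \<omega> = real_cond_exp N (F s) (X t) \<omega>" by (rule AE_mp) auto
  qed (use iX in auto)
  also have "\<dots> = expectation (X t)" by (rule S.real_cond_exp_int(2)[OF iX(1)])
  finally have EX: "expectation (X t) = expectation (X s)" by simp
  have cg: "continuous_on UNIV g"
    using d1 by (intro continuous_at_imp_continuous_on ballI) (blast intro: DERIV_isCont)
  then have [measurable]: "g \<in> borel_measurable borel" by (rule borel_measurable_continuous_onI)
  have "bounded (g ` {0..K})"
    by (intro compact_imp_bounded compact_continuous_image continuous_on_subset[OF cg]) auto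
  then obtain C where C: "\<And>y. y \<in> {0..K} \<Longrightarrow> \<bar>g y\<bar> \<le> C" unfolding bounded_iff real_norm_def ball_simps by blast
  \<comment> \<open>If K < 0 the interval {0..K} is empty and \<open>C\<close> may be negative; the
    absolute value covers this case.\<close>
  have C': "\<bar>g y\<bar> \<le> \<bar>C\<bar>" if "y \<ge> 0" for y
    using C[of y] K[of y] that by (cases "y \<le> K") auto
  have ig: "integrable N (\<lambda>\<omega>. g (Y r \<omega>))" if "r \<ge> 0" for r
    using that by (intro integrable_const_bound[where B="\<bar>C\<bar>"] AE_I2) (auto simp: C' Y_nonneg)
  have ch: "continuous_on UNIV (cosh_gen g'')"
    unfolding cosh_gen_def[abs_def] by (intro continuous_intros c2) auto
  have dec: "integral {s..t} (\<lambda>r. cosh_gen g'' (Y r \<omega>)) = g (Y t \<omega>) - g (Y s \<omega>) - (X t \<omega> - X s \<omega>)"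
    if \<omega>: "\<omega> \<in> space N" for \<omega>
  proof -
    have "(\<lambda>r. cosh_gen g'' (Y r \<omega>)) integrable_on {0..t}"
      by (intro integrable_continuous_interval continuous_on_compose2[OF ch] Y_continuous \<omega>) auto
    from Henstock_Kurzweil_Integration.integral_combine[OF st this]
    show ?thesis by (simp add: X_def)
  qed
  have i: "integrable N (\<lambda>\<omega>. g (Y t \<omega>) - g (Y s \<omega>) - (X t \<omega> - X s \<omega>))"
    using ig iX st by auto
  then show "integrable N (\<lambda>\<omega>. integral {s..t} (\<lambda>r. cosh_gen g'' (Y r \<omega>)))"
    by (subst Bochner_Integration.integrable_cong[OF refl dec])
  have "expectation (\<lambda>\<omega>. integral {s..t} (\<lambda>r. cosh_gen g'' (Y r \<omega>)))
      = expectation (\<lambda>\<omega>. g (Y t \<omega>) - g (Y s \<omega>) - (X t \<omega> - X s \<omega>))"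
    by (intro Bochner_Integration.integral_cong dec) auto
  also have "\<dots> = expectation (\<lambda>\<omega>. g (Y t \<omega>)) - expectation (\<lambda>\<omega>. g (Y s \<omega>))"
    using ig iX st EX by simp
  finally show "expectation (\<lambda>\<omega>. g (Y t \<omega>)) - expectation (\<lambda>\<omega>. g (Y s \<omega>)) =
      expectation (\<lambda>\<omega>. integral {s..t} (\<lambda>r. cosh_gen g'' (Y r \<omega>)))" by simp
qed

text \<open>Multiplying g by the cutoff max(0, 1 - y/q)^4 with q = n + 1 gives compact support. By
  \<open>cutoff_bounds\<close> the generator stays below 27C uniformly in n while converging
  pointwise, so dominated convergence applies twice, to the time integral and to the
  expectation.\<close>

lemma dynkin:
  assumes bg: "bounded_generator C g g' g''" and st: "0 \<le> s" "s \<le> t"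
  shows "expectation (\<lambda>\<omega>. g (Y t \<omega>)) - expectation (\<lambda>\<omega>. g (Y s \<omega>)) =
      expectation (\<lambda>\<omega>. integral {s..t} (\<lambda>r. cosh_gen g'' (Y r \<omega>)))"
proof -
  have d1: "(g has_real_derivative g' y) (at y)" and d2: "(g' has_real_derivative g'' y) (at y)"
    and c2: "continuous_on UNIV g''" for y
    using bg by (auto simp: bounded_generator_def)
  have b: "\<bar>g y\<bar> \<le> C" "(1 + y) * \<bar>g' y\<bar> \<le> C" "(y^2 + 2 * y) * \<bar>g'' y\<bar> \<le> C" if "y \<ge> 0" for y
    using bg that by (auto simp: bounded_generator_def)
  define q where "q n = real (Suc n)" for n
  define \<mu> where "\<mu> n y = max 0 (1 - y / q n)" for n y
  define h where "h n y = g y * \<mu> n y ^ 4" for n y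
  define h' where "h' n y = g' y * \<mu> n y ^ 4 + g y * (- (4 / q n) * \<mu> n y ^ 3)" for n y
  define h'' where "h'' n y = g'' y * \<mu> n y ^ 4 + 2 * (g' y * (- (4 / q n) * \<mu> n y ^ 3)) +
      g y * (12 / (q n)^2 * \<mu> n y ^ 2)" for n y
  have q: "q n \<ge> 1" for n by (simp add: q_def)
  have \<mu>d: "((\<lambda>y. \<mu> n y ^ Suc (Suc k)) has_real_derivative - (real (Suc (Suc k)) / q n) * \<mu> n y ^ Suc k) (at y)" for n k y
  proof -
    have "((\<lambda>y. 1 - y / q n) has_real_derivative - (1 / q n)) (at y)"
      using q[of n] by (auto intro!: derivative_eq_intros)
    from DERIV_chain2[OF DERIV_pos_part_power this, of k] show ?thesis
      by (simp add: \<mu>_def mult_ac)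
  qed
  have \<mu>4: "((\<lambda>y. \<mu> n y ^ 4) has_real_derivative - (4 / q n) * \<mu> n y ^ 3) (at y)" for n y
    using \<mu>d[of n 2 y] by (simp add: eval_nat_numeral)
  have \<mu>3: "((\<lambda>y. \<mu> n y ^ 3) has_real_derivative - (3 / q n) * \<mu> n y ^ 2) (at y)" for n y
    using \<mu>d[of n 1 y] by (simp add: eval_nat_numeral)
  have hd1: "(h n has_real_derivative h' n y) (at y)" for n y
    unfolding h_def h'_def by (rule DERIV_cong[OF DERIV_mult[OF d1 \<mu>4]]) (simp add: algebra_simps)
  have hd2: "(h' n has_real_derivative h'' n y) (at y)" for n y
    unfolding h''_def h'_def
    by (rule DERIV_cong[OF DERIV_add[OF DERIV_mult[OF d2 \<mu>4] DERIV_mult[OF d1 DERIV_cmult[OF \<mu>3]]]])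
       (simp add: algebra_simps power2_eq_square)
  have cg: "continuous_on UNIV g" "continuous_on UNIV g'"
    using d1 d2 by (auto intro!: continuous_at_imp_continuous_on intro: DERIV_isCont)
  have c\<mu>: "continuous_on UNIV (\<mu> n)" for n
    unfolding \<mu>_def[abs_def] using q[of n] by (intro continuous_intros) auto
  have hc: "continuous_on UNIV (h'' n)" for n
    unfolding h''_def[abs_def] by (intro continuous_intros cg c2 c\<mu>)
  have hK: "h n y = 0" if "y \<ge> q n" for n y
    using that q[of n] by (simp add: h_def \<mu>_def)
  have \<mu>lim: "(\<lambda>n. \<mu> n y) \<longlonglongrightarrow> 1" for y
  proof -
    have "(\<lambda>n. max 0 (1 - y / q n)) \<longlonglongrightarrow> max 0 (1 - 0)"
      unfolding q_def by (intro tendsto_intros LIMSEQ_Suc[OF lim_const_over_n])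
    then show ?thesis by (simp add: \<mu>_def)
  qed
  have hlim: "(\<lambda>n. h n y) \<longlonglongrightarrow> g y" for y
  proof -
    have "(\<lambda>n. g y * \<mu> n y ^ 4) \<longlonglongrightarrow> g y * 1 ^ 4" by (intro tendsto_intros \<mu>lim)
    then show ?thesis by (simp add: h_def)
  qed
  have Lhlim: "(\<lambda>n. cosh_gen (h'' n) y) \<longlonglongrightarrow> cosh_gen g'' y" for y
  proof -
    have q0: "(\<lambda>n. a / q n) \<longlonglongrightarrow> 0" for a unfolding q_def by (rule LIMSEQ_Suc[OF lim_const_over_n])
    have "(\<lambda>n. (y^2 + 2 * y) / 2 * (g'' y * \<mu> n y ^ 4 + 2 * (g' y * (- (4 / q n) * \<mu> n y ^ 3)) +
      g y * (12 / (q n) * (1 / q n) * \<mu> n y ^ 2))) \<longlonglongrightarrow> (y^2 + 2 * y) / 2 * (g'' y * 1 ^ 4 + 2 * (g' y * (- 0 * 1 ^ 3)) +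
      g y * (0 * 0 * 1 ^ 2))"
      by (intro tendsto_intros \<mu>lim q0)
    then show ?thesis by (simp add: cosh_gen_def h''_def power2_eq_square)
  qed
  have hb: "\<bar>h n y\<bar> \<le> C" if "y \<ge> 0" for n y
  proof -
    have "\<bar>h n y\<bar> = \<bar>g y\<bar> * \<mu> n y ^ 4" by (simp add: h_def abs_mult)
    also have "\<dots> \<le> C * 1" using b(1)[OF that] q[of n] that
      by (intro mult_mono power_le_one) (auto simp: \<mu>_def)
    finally show ?thesis by simp
  qed
  have Lhb: "\<bar>cosh_gen (h'' n) y\<bar> \<le> 27 * C" if "y \<ge> 0" for n y
    unfolding cosh_gen_def h''_def \<mu>_def by (rule cutoff_bounds[OF that q b[OF that]])
  have C: "C \<ge> 0" using b(1)[of 0] by linarith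
  have ch: "continuous_on UNIV (cosh_gen (h'' n))" for n
    unfolding cosh_gen_def[abs_def] by (intro continuous_intros hc) auto
  have [measurable]: "h n \<in> borel_measurable borel" for n
    unfolding h_def[abs_def] by (intro borel_measurable_continuous_onI continuous_intros cg c\<mu>)
  have [measurable]: "g \<in> borel_measurable borel"
    by (intro borel_measurable_continuous_onI cg)
  have Elim: "(\<lambda>n. expectation (\<lambda>\<omega>. h n (Y r \<omega>))) \<longlonglongrightarrow> expectation (\<lambda>\<omega>. g (Y r \<omega>))" if "r \<ge> 0" for r
    using that by (intro integral_dominated_convergence[where w="\<lambda>_. C"] AE_I2 hlim)
       (auto simp: hb Y_nonneg)
  let ?I = "\<lambda>n \<omega>. integral {s..t} (\<lambda>r. cosh_gen (h'' n) (Y r \<omega>))"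
  let ?J = "\<lambda>\<omega>. integral {s..t} (\<lambda>r. cosh_gen g'' (Y r \<omega>))"
  have Ii: "integrable N (?I n)" for n
    using dynkin_compact_support(1)[OF hd1 hd2 hc hK st] .
  have io: "(\<lambda>r. cosh_gen (h'' n) (Y r \<omega>)) integrable_on {s..t}" if "\<omega> \<in> space N" for n \<omega>
    using st by (intro integrable_continuous_interval continuous_on_compose2[OF ch] Y_continuous that) auto
  have Ilim: "(\<lambda>n. ?I n \<omega>) \<longlonglongrightarrow> ?J \<omega>" if "\<omega> \<in> space N" for \<omega>
    by (rule dominated_convergence(2)[where h="\<lambda>_. 27 * C"])
       (auto simp: Lhb Y_nonneg Lhlim io that)
  have Ib: "norm (?I n \<omega>) \<le> 27 * C * (t - s)" if "\<omega> \<in> space N" for n \<omega>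
    using st that by (intro integral_bound continuous_on_compose2[OF ch] Y_continuous) (auto simp: Lhb Y_nonneg)
  have ILim: "(\<lambda>n. expectation (?I n)) \<longlonglongrightarrow> expectation ?J"
  proof (rule integral_dominated_convergence[where w="\<lambda>_. 27 * C * (t - s)"])
    have [measurable]: "?I n \<in> borel_measurable N" for n using Ii by auto
    show "?I n \<in> borel_measurable N" for n by measurable
    \<comment> \<open>The time integral for g is measurable as a pathwise limit of the truncated
      ones, which are integrable already.\<close>
    show "?J \<in> borel_measurable N" by (rule borel_measurable_LIMSEQ_real[OF Ilim]) auto
  qed (use Ilim Ib in auto)
  have "(\<lambda>n. expectation (?I n)) = (\<lambda>n. expectation (\<lambda>\<omega>. h n (Y t \<omega>)) - expectation (\<lambda>\<omega>. h n (Y s \<omega>)))"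
    using dynkin_compact_support(2)[OF hd1 hd2 hc hK st] by auto
  then have "(\<lambda>n. expectation (?I n)) \<longlonglongrightarrow> expectation (\<lambda>\<omega>. g (Y t \<omega>)) - expectation (\<lambda>\<omega>. g (Y s \<omega>))"
    using st by (auto intro!: tendsto_intros Elim)
  then show ?thesis using ILim LIMSEQ_unique by blast
qed

lemma dynkin_lipschitz:
  assumes bg: "bounded_generator C g g' g''" and st: "0 \<le> s" "s \<le> t"
  shows "\<bar>expectation (\<lambda>\<omega>. g (Y t \<omega>)) - expectation (\<lambda>\<omega>. g (Y s \<omega>))\<bar> \<le> C * (t - s)"
proof -
  let ?J = "\<lambda>\<omega>. integral {s..t} (\<lambda>r. cosh_gen g'' (Y r \<omega>))"
  have b: "\<bar>cosh_gen g'' y\<bar> \<le> C" if "y \<ge> 0" for y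
  proof -
    have "(y^2 + 2 * y) * \<bar>g'' y\<bar> \<le> C" "0 \<le> (y^2 + 2 * y) * \<bar>g'' y\<bar>"
      using bg that by (auto simp: bounded_generator_def)
    moreover have "\<bar>cosh_gen g'' y\<bar> = (y^2 + 2 * y) * \<bar>g'' y\<bar> / 2"
      using that by (simp add: cosh_gen_def abs_mult)
    ultimately show ?thesis by linarith
  qed
  have ch: "continuous_on UNIV (cosh_gen g'')"
    using bg unfolding cosh_gen_def[abs_def] bounded_generator_def by (intro continuous_intros) auto
  have J: "norm (?J \<omega>) \<le> C * (t - s)" if "\<omega> \<in> space N" for \<omega>
    using st that by (intro integral_bound continuous_on_compose2[OF ch] Y_continuous) (auto simp: b Y_nonneg)
  have C: "0 \<le> C * (t - s)" using b[of 0] st by (intro mult_nonneg_nonneg) auto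
  \<comment> \<open>Were the integrand not integrable, its expectation would be 0 by convention and
    the bound trivial; hence no measurability of \<open>?J\<close> has to be shown here.\<close>
  have "norm (expectation ?J) \<le> C * (t - s)"
  proof (cases "integrable N ?J")
    case True
    have "norm (expectation ?J) \<le> expectation (\<lambda>\<omega>. norm (?J \<omega>))" by (rule integral_norm_bound)
    also have "\<dots> \<le> expectation (\<lambda>\<omega>. C * (t - s))"
      using True J by (intro integral_mono) auto
    finally show ?thesis by (simp add: prob_space)
  next
    case False
    then show ?thesis using C by (simp add: not_integrable_integral_eq)
  qed
  then show ?thesis using dynkin[OF bg st] by simp
qed

text \<open>Dynkin's formula for g leaves the time average of E G(Y_r) with G =
  \<open>cosh_gen g''\<close>. A second application, to G, shows that this function of r is
  D-Lipschitz, so freezing r at s costs at most D h over a time h. The expectation passes through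
  the time integral by means of Riemann sums.\<close>

lemma dynkin_second_order:
  assumes bg: "bounded_generator C g g' g''"
    and bG: "bounded_generator D (cosh_gen g'') G' G''" and s: "0 \<le> s" and h: "0 \<le> h"
  shows "\<bar>expectation (\<lambda>\<omega>. g (Y (s + h) \<omega>)) - expectation (\<lambda>\<omega>. g (Y s \<omega>))
      - h * expectation (\<lambda>\<omega>. cosh_gen g'' (Y s \<omega>))\<bar> \<le> D * h^2"
proof -
  let ?G = "cosh_gen g''"
  let ?J = "\<lambda>\<omega>. integral {s..s + h} (\<lambda>r. ?G (Y r \<omega>))"
  let ?S = "\<lambda>n \<omega>. h / real n * (\<Sum>k<n. ?G (Y (s + real k * (h / real n)) \<omega>))"
  let ?e = "\<lambda>r. expectation (\<lambda>\<omega>. ?G (Y r \<omega>))"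
  have ch: "continuous_on UNIV ?G"
    using bg unfolding cosh_gen_def[abs_def] bounded_generator_def by (intro continuous_intros) auto
  then have [measurable]: "?G \<in> borel_measurable borel" by (rule borel_measurable_continuous_onI)
  have b: "\<bar>?G y\<bar> \<le> D" if "y \<ge> 0" for y
    using bG that by (auto simp: bounded_generator_def)
  have D: "D \<ge> 0" using b[of 0] by linarith
  have r0: "0 \<le> s + real k * (h / real n)" for k n using s h by simp
  have Si: "integrable N (\<lambda>\<omega>. ?G (Y r \<omega>))" if "r \<ge> 0" for r
    using that by (intro integrable_const_bound[where B=D] AE_I2) (auto simp: b Y_nonneg)
  have Slim: "(\<lambda>n. ?S n \<omega>) \<longlonglongrightarrow> ?J \<omega>" if "\<omega> \<in> space N" for \<omega>
    using s that by (intro riemann_sum_tendsto h continuous_on_compose2[OF ch] Y_continuous) auto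
  have Sb: "norm (?S n \<omega>) \<le> h * D" for n \<omega>
  proof -
    have "\<bar>\<Sum>k<n. ?G (Y (s + real k * (h / real n)) \<omega>)\<bar> \<le> (\<Sum>k<n. D)"
      by (rule order_trans[OF sum_abs]) (intro sum_mono b Y_nonneg)
    then have "\<bar>?S n \<omega>\<bar> \<le> h / real n * (real n * D)"
      using h by (simp add: abs_mult del: times_divide_eq_left) (intro mult_left_mono, auto)
    \<comment> \<open>For n = 0 the mesh h / 0 is 0 by convention, so the domination holds for every
      n.\<close>
    also have "\<dots> \<le> h * D" using h D by (cases "n = 0") auto
    finally show ?thesis by simp
  qed
  have "(\<lambda>n. expectation (?S n)) \<longlonglongrightarrow> expectation ?J"
  proof (rule integral_dominated_convergence[where w="\<lambda>_. h * D"])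
    show m: "?S n \<in> borel_measurable N" for n
      using r0 by (intro borel_measurable_times borel_measurable_sum borel_measurable_const) measurable
    show "?J \<in> borel_measurable N" by (rule borel_measurable_LIMSEQ_real[OF Slim m])
  qed (use Slim Sb in auto)
  moreover have ES: "expectation (?S n) = h / real n * (\<Sum>k<n. ?e (s + real k * (h / real n)))" for n
    using Si r0 by simp
  ultimately have "(\<lambda>n. h / real n * (\<Sum>k<n. ?e (s + real k * (h / real n))) - h * ?e s) \<longlonglongrightarrow> expectation ?J - h * ?e s"
    unfolding ES by (intro tendsto_diff tendsto_const)
  then have "(\<lambda>n. \<bar>h / real n * (\<Sum>k<n. ?e (s + real k * (h / real n))) - h * ?e s\<bar>) \<longlonglongrightarrow> \<bar>expectation ?J - h * ?e s\<bar>"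
    by (rule tendsto_rabs)
  moreover have "\<bar>h / real n * (\<Sum>k<n. ?e (s + real k * (h / real n))) - h * ?e s\<bar> \<le> D * h^2" if n: "n \<ge> 1" for n
  proof -
    have step: "\<bar>?e (s + real k * (h / real n)) - ?e s\<bar> \<le> D * h" if k: "k \<in> {..<n}" for k
    proof -
      have "real k / real n \<le> 1" using k n by simp
      then have "real k / real n * h \<le> 1 * h" using h by (rule mult_right_mono)
      then have kh: "0 \<le> real k * (h / real n)" "real k * (h / real n) \<le> h" using h by auto
      have "\<bar>?e (s + real k * (h / real n)) - ?e s\<bar> \<le> D * (s + real k * (h / real n) - s)"
        by (rule dynkin_lipschitz[OF bG s]) (use kh in linarith)
      also have "\<dots> \<le> D * h" by (rule mult_left_mono[OF _ D]) (use kh in linarith)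
      finally show ?thesis .
    qed
    let ?\<Delta> = "\<Sum>k<n. ?e (s + real k * (h / real n)) - ?e s"
    have eq: "h / real n * (\<Sum>k<n. ?e (s + real k * (h / real n))) - h * ?e s = h / real n * ?\<Delta>"
      using n by (simp add: sum_subtractf field_simps)
    have "\<bar>?\<Delta>\<bar> \<le> (\<Sum>k<n. D * h)"
      by (rule order_trans[OF sum_abs]) (rule sum_mono[OF step])
    then have "\<bar>?\<Delta>\<bar> \<le> real n * (D * h)" by simp
    then have "h / real n * \<bar>?\<Delta>\<bar> \<le> h / real n * (real n * (D * h))"
      by (rule mult_left_mono) (use h in simp)
    moreover have "h / real n * (real n * (D * h)) = D * h^2" using n by (simp add: power2_eq_square)
    moreover have "\<bar>h / real n * ?\<Delta>\<bar> = h / real n * \<bar>?\<Delta>\<bar>" using h by (simp add: abs_mult)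
    ultimately show ?thesis by (simp only: eq)
  qed
  ultimately have "\<bar>expectation ?J - h * ?e s\<bar> \<le> D * h^2"
    by (intro LIMSEQ_le_const2[where X="\<lambda>n. \<bar>h / real n * (\<Sum>k<n. ?e (s + real k * (h / real n))) - h * ?e s\<bar>"]) auto
  then show ?thesis using dynkin[OF bg s, of "s + h"] h by simp
qed

end

section \<open>Exponentials under the generator, and the pointwise duality\<close>

text \<open>With w = by and E = exp(-w) every power of y is paired with a power of b: the weighted
  derivatives become bE + wE and w^2 E + 2b wE.\<close>

lemma bounded_generator_exp:
  fixes b :: real
  assumes b: "b \<ge> 0"
  shows "bounded_generator (2 + 2 * b) (\<lambda>y. exp (-(b * y))) (\<lambda>y. - b * exp (-(b * y))) (\<lambda>y. b^2 * exp (-(b * y)))"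
  unfolding bounded_generator_def
proof (intro conjI allI impI)
  show "((\<lambda>y. exp (-(b * y))) has_real_derivative - b * exp (-(b * y))) (at y)" for y
    by (auto intro!: derivative_eq_intros)
  show "((\<lambda>y. - b * exp (-(b * y))) has_real_derivative b^2 * exp (-(b * y))) (at y)" for y
    by (auto intro!: derivative_eq_intros simp: power2_eq_square)
  show "continuous_on UNIV (\<lambda>y. b^2 * exp (-(b * y)))" by (intro continuous_intros)
next
  fix y :: real assume y: "y \<ge> 0"
  define w where "w = b * y"
  define E where "E = exp (-w)"
  have w: "w \<ge> 0" using b y by (simp add: w_def)
  have E: "0 \<le> E" "E \<le> 1" "w * E \<le> 1" "w^2 * E \<le> 2" "w * E \<ge> 0"
    using exp_neg_bounds[OF w] w by (auto simp: E_def)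
  have bE: "b * E \<le> b" "b * (w * E) \<le> b" using b E by (auto simp: mult_left_le)
  show "\<bar>exp (-(b * y))\<bar> \<le> 2 + 2 * b"
    using E(2) b unfolding w_def[symmetric] E_def[symmetric] abs_of_nonneg[OF E(1)] by linarith
  have "(1 + y) * \<bar>- b * exp (-(b * y))\<bar> = b * E + w * E"
    using b by (simp add: E_def w_def abs_mult algebra_simps)
  then show "(1 + y) * \<bar>- b * exp (-(b * y))\<bar> \<le> 2 + 2 * b" using bE E b by linarith
  have "(y^2 + 2 * y) * \<bar>b^2 * exp (-(b * y))\<bar> = w^2 * E + 2 * (b * (w * E))"
    using b by (simp add: E_def w_def abs_mult algebra_simps power2_eq_square)
  then show "(y^2 + 2 * y) * \<bar>b^2 * exp (-(b * y))\<bar> \<le> 2 + 2 * b" using bE E b by linarith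
qed

text \<open>Here the growth of the constant matters: it will be evaluated at b = \<beta>X_k and
  averaged over the chain, so it may grow at most like the second moment that the chain
  possesses.\<close>

lemma bounded_generator_cosh_gen_exp:
  fixes b :: real
  assumes b: "b \<ge> 0"
  shows "bounded_generator (26 * (1 + b)^2) (cosh_gen (\<lambda>y. b^2 * exp (-(b * y))))
    (\<lambda>y. b^2 / 2 * ((2 * y + 2) - b * (y^2 + 2 * y)) * exp (-(b * y)))
    (\<lambda>y. b^2 / 2 * (2 - 2 * b * (2 * y + 2) + b^2 * (y^2 + 2 * y)) * exp (-(b * y)))"
  unfolding bounded_generator_def cosh_gen_def
proof (intro conjI allI impI)
  fix y :: real
  have e: "((\<lambda>y. exp (-(b * y))) has_real_derivative - b * exp (-(b * y))) (at y)"
    by (auto intro!: derivative_eq_intros)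
  have p: "((\<lambda>y. b^2 / 2 * (y^2 + 2 * y)) has_real_derivative b^2 / 2 * (2 * y + 2)) (at y)"
    by (auto intro!: derivative_eq_intros)
  show "((\<lambda>y. (y^2 + 2 * y) / 2 * (b^2 * exp (-(b * y)))) has_real_derivative
      b^2 / 2 * ((2 * y + 2) - b * (y^2 + 2 * y)) * exp (-(b * y))) (at y)"
  proof -
    have "(\<lambda>y. (y^2 + 2 * y) / 2 * (b^2 * exp (-(b * y)))) = (\<lambda>y. b^2 / 2 * (y^2 + 2 * y) * exp (-(b * y)))"
      by (simp add: fun_eq_iff)
    then show ?thesis
      by (simp only:) (rule DERIV_cong[OF DERIV_mult[OF p e]], simp add: algebra_simps)
  qed
  have p: "((\<lambda>y. b^2 / 2 * ((2 * y + 2) - b * (y^2 + 2 * y))) has_real_derivative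
      b^2 / 2 * (2 - b * (2 * y + 2))) (at y)"
    by (auto intro!: derivative_eq_intros)
  show "((\<lambda>y. b^2 / 2 * ((2 * y + 2) - b * (y^2 + 2 * y)) * exp (-(b * y))) has_real_derivative
      b^2 / 2 * (2 - 2 * b * (2 * y + 2) + b^2 * (y^2 + 2 * y)) * exp (-(b * y))) (at y)"
    by (rule DERIV_cong[OF DERIV_mult[OF p e]]) (simp add: algebra_simps power2_eq_square)
next
  show "continuous_on UNIV (\<lambda>y. b^2 / 2 * (2 - 2 * b * (2 * y + 2) + b^2 * (y^2 + 2 * y)) * exp (-(b * y)))"
    by (intro continuous_intros) auto
next
  fix y :: real assume y: "y \<ge> 0"
  define w where "w = b * y"
  define E where "E = exp (-w)"
  have w: "w \<ge> 0" using b y by (simp add: w_def)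
  have E: "0 \<le> E" "E \<le> 1" "w * E \<le> 1" "w^2 * E \<le> 2" "w^3 * E \<le> 6" "w^4 * E \<le> 24"
    using exp_neg_bounds[OF w] w by (auto simp: E_def)
  have bs: "b * (w * E) \<le> b * 1" "b * (w^2 * E) \<le> b * 2" "b * (w^3 * E) \<le> b * 6"
    "b^2 * E \<le> b^2 * 1" "b^2 * (w * E) \<le> b^2 * 1" "b^2 * (w^2 * E) \<le> b^2 * 2"
    by (rule mult_left_mono; use b E in simp)+
  have D: "26 * (1 + b)^2 = 26 + 52 * b + 26 * b^2" by (simp add: power2_eq_square algebra_simps)
  have b2: "b^2 \<ge> 0" by simp
  \<comment> \<open>Naming the monomials w^k E and their products with b and b^2 makes the three
    remaining estimates linear.\<close>
  define e1 e2 e3 e4 b' where e: "e1 = w * E" "e2 = w^2 * E" "e3 = w^3 * E" "e4 = w^4 * E" "b' = b^2"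
  define c1 c2 c3 d0 d1 d2 where c: "c1 = b * e1" "c2 = b * e2" "c3 = b * e3" "d0 = b' * E" "d1 = b' * e1" "d2 = b' * e2"
  note lin = bs[folded e, folded c, unfolded mult_1_right] E(3-6)[folded e] b b2[folded e]
  have "\<bar>(y^2 + 2 * y) / 2 * (b^2 * exp (-(b * y)))\<bar> = w^2 * E / 2 + b * (w * E)"
    using y b by (simp add: E_def w_def abs_mult algebra_simps power2_eq_square)
  also have "\<dots> \<le> 26 * (1 + b)^2" unfolding D e[symmetric] c[symmetric] using lin by linarith
  finally show "\<bar>(y^2 + 2 * y) / 2 * (b^2 * exp (-(b * y)))\<bar> \<le> 26 * (1 + b)^2" .
  have "(1 + y) * \<bar>b^2 / 2 * ((2 * y + 2) - b * (y^2 + 2 * y)) * exp (-(b * y))\<bar> =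
     \<bar>(1 + y) * (b^2 / 2 * ((2 * y + 2) - b * (y^2 + 2 * y)) * exp (-(b * y)))\<bar>"
    using y by (simp add: abs_mult)
  also have "(1 + y) * (b^2 / 2 * ((2 * y + 2) - b * (y^2 + 2 * y)) * exp (-(b * y))) =
     (b + w) * (2 * w + 2 * b - w^2 - 2 * b * w) * E / 2"
    by (simp add: E_def w_def algebra_simps power2_eq_square)
  also have "\<bar>\<dots>\<bar> = (b + w) * \<bar>2 * w + 2 * b - w^2 - 2 * b * w\<bar> * E / 2"
    using b w E by (simp add: abs_mult)
  also have "\<dots> \<le> (b + w) * (2 * w + 2 * b + w^2 + 2 * b * w) * E / 2"
  proof (intro divide_right_mono mult_right_mono mult_left_mono)
    have "0 \<le> w^2" "0 \<le> b * w" using b w by auto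
    then show "\<bar>2 * w + 2 * b - w^2 - 2 * b * w\<bar> \<le> 2 * w + 2 * b + w^2 + 2 * b * w"
      using b w by linarith
  qed (use b w E in auto)
  also have "\<dots> = b^2 * E + 2 * (b * (w * E)) + b^2 * (w * E) + 3 / 2 * (b * (w^2 * E)) + w^2 * E + w^3 * E / 2"
    by (simp add: algebra_simps power2_eq_square power3_eq_cube)
  also have "\<dots> \<le> 26 * (1 + b)^2" unfolding D e[symmetric] c[symmetric] using lin by linarith
  finally show "(1 + y) * \<bar>b^2 / 2 * ((2 * y + 2) - b * (y^2 + 2 * y)) * exp (-(b * y))\<bar> \<le> 26 * (1 + b)^2" .
  have "(y^2 + 2 * y) * \<bar>b^2 / 2 * (2 - 2 * b * (2 * y + 2) + b^2 * (y^2 + 2 * y)) * exp (-(b * y))\<bar> =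
     \<bar>(y^2 + 2 * y) * (b^2 / 2 * (2 - 2 * b * (2 * y + 2) + b^2 * (y^2 + 2 * y)) * exp (-(b * y)))\<bar>"
    using y by (simp add: abs_mult)
  also have "(y^2 + 2 * y) * (b^2 / 2 * (2 - 2 * b * (2 * y + 2) + b^2 * (y^2 + 2 * y)) * exp (-(b * y))) =
     (w^2 + 2 * b * w) * (2 - 4 * w - 4 * b + w^2 + 2 * b * w) * E / 2"
    by (simp add: E_def w_def algebra_simps power2_eq_square)
  also have "\<bar>\<dots>\<bar> = (w^2 + 2 * b * w) * \<bar>2 - 4 * w - 4 * b + w^2 + 2 * b * w\<bar> * E / 2"
    using b w E by (simp add: abs_mult)
  also have "\<dots> \<le> (w^2 + 2 * b * w) * (2 + 4 * w + 4 * b + w^2 + 2 * b * w) * E / 2"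
  proof (intro divide_right_mono mult_right_mono mult_left_mono)
    have "0 \<le> w^2" "0 \<le> b * w" using b w by auto
    then show "\<bar>2 - 4 * w - 4 * b + w^2 + 2 * b * w\<bar> \<le> 2 + 4 * w + 4 * b + w^2 + 2 * b * w"
      using b w by linarith
  qed (use b w E in auto)
  also have "\<dots> = w^2 * E + 2 * (w^3 * E) + 6 * (b * (w^2 * E)) + w^4 * E / 2 + 2 * (b * (w^3 * E))
      + 2 * (b * (w * E)) + 4 * (b^2 * (w * E)) + 2 * (b^2 * (w^2 * E))"
    by (simp add: algebra_simps power2_eq_square power3_eq_cube power4_eq_xxxx)
  \<comment> \<open>The constant originates here: the terms free of b give 2 + 12 + 12 = 26. Those
    in b and b^2 have coefficients at most 26 and 8, below the available 52 and 26.\<close>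
  also have "\<dots> \<le> 26 * (1 + b)^2" unfolding D e[symmetric] c[symmetric] using lin by linarith
  finally show "(y^2 + 2 * y) * \<bar>b^2 / 2 * (2 - 2 * b * (2 * y + 2) + b^2 * (y^2 + 2 * y)) * exp (-(b * y))\<bar>
      \<le> 26 * (1 + b)^2" .
qed

lemma exp_le_second_order:
  fixes x :: real assumes "x \<ge> 0" shows "exp x \<le> 1 + x + x^2 / 2 * exp x"
proof -
  obtain t where t: "\<bar>t\<bar> \<le> \<bar>x\<bar>" and e: "exp x = (\<Sum>m<2. x ^ m / fact m) + exp t / fact 2 * x ^ 2"
    using Maclaurin_exp_le[of x 2] by blast
  have "exp t * x^2 \<le> exp x * x^2" using t assms by (intro mult_right_mono) auto
  moreover have "exp x = 1 + x + exp t * x^2 / 2" using e by (simp add: eval_nat_numeral)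
  moreover have "x^2 / 2 * exp x = exp x * x^2 / 2" by simp
  ultimately show ?thesis by linarith
qed

text \<open>Over a time h the drift contributes h \<beta>x w exp(-w) and the noise (h/2) w^2
  exp(-w), with w = \<beta>xy. Their sum is h times the generator in y applied to exp(-\<beta>xy).
  What remains is at most 2\<eta>^2 + h^2 + 5h\<eta> with \<eta> = \<beta>hx, hence below 5(h +
  \<eta>)^2.\<close>

lemma generator_one_step:
  fixes \<beta> x y h :: real
  assumes \<beta>: "\<beta> > 0" and x: "x \<ge> 0" and y: "y \<ge> 0" and h: "0 \<le> h" "h \<le> 1"
  defines "a \<equiv> \<beta> * (x / (1 + \<beta> * h * x)) * y"
  shows "\<bar>exp (-a) + (exp h - 1) / 2 * (a^2 * exp (-a)) - exp (-(\<beta> * x * y))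
      - h * cosh_gen (\<lambda>y. (\<beta> * x)^2 * exp (-(\<beta> * x * y))) y\<bar> \<le> 5 * (h * (1 + \<beta> * x))^2"
proof -
  define w where "w = \<beta> * x * y"
  define \<eta> where "\<eta> = \<beta> * h * x"
  have w: "w \<ge> 0" and \<eta>: "\<eta> \<ge> 0" using \<beta> x y h by (auto simp: w_def \<eta>_def)
  have a: "a = w / (1 + \<eta>)" by (simp add: a_def w_def \<eta>_def)
  have a0: "a \<ge> 0" using a w \<eta> by simp
  define A where "A = a^2 * exp (-a)"
  define W where "W = w^2 * exp (-w)"
  have A: "0 \<le> A" "A \<le> 2" using exp_neg_bounds(2)[OF a0] by (auto simp: A_def)
  have T1: "\<bar>exp (-a) - exp (-w) - \<eta> * (w * exp (-w))\<bar> \<le> 2 * \<eta>^2"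
    unfolding a by (rule exp_scaling_taylor[OF w \<eta>])
  have T2: "\<bar>A - W\<bar> \<le> 10 * \<eta>"
    unfolding A_def W_def a by (rule square_exp_scaling_bound[OF w \<eta>])
  have h2: "0 \<le> exp h - 1 - h" "exp h - 1 - h \<le> h^2"
    using exp_ge_add_one_self[of h] exp_bound[of h] h by linarith+
  have "cosh_gen (\<lambda>y. (\<beta> * x)^2 * exp (-(\<beta> * x * y))) y = W / 2 + \<beta> * x * (w * exp (-w))"
    by (simp add: cosh_gen_def W_def w_def algebra_simps power2_eq_square)
  then have "exp (-a) + (exp h - 1) / 2 * (a^2 * exp (-a)) - exp (-(\<beta> * x * y))
      - h * cosh_gen (\<lambda>y. (\<beta> * x)^2 * exp (-(\<beta> * x * y))) y =
      (exp (-a) - exp (-w) - \<eta> * (w * exp (-w))) + (exp h - 1 - h) / 2 * A + h / 2 * (A - W)"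
    unfolding A_def[symmetric] w_def[symmetric] by (simp add: \<eta>_def algebra_simps diff_divide_distrib)
  also have "\<bar>\<dots>\<bar> \<le> 2 * \<eta>^2 + h^2 + 5 * (h * \<eta>)"
  proof -
    have "(exp h - 1 - h) / 2 * A \<le> h^2 / 2 * 2"
      using h2 A by (intro mult_mono) auto
    moreover have "0 \<le> (exp h - 1 - h) / 2 * A"
      by (intro mult_nonneg_nonneg divide_nonneg_nonneg h2 A) simp
    moreover have "\<bar>h / 2 * (A - W)\<bar> \<le> h / 2 * (10 * \<eta>)"
      using T2 h by (simp only: abs_mult) (intro mult_mono, auto)
    ultimately show ?thesis using T1 by linarith
  qed
  also have "\<dots> \<le> 5 * (h + \<eta>)^2"
    using mult_nonneg_nonneg[OF h(1) \<eta>] by (simp add: power2_eq_square algebra_simps)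
  also have "h + \<eta> = h * (1 + \<beta> * x)" by (simp add: \<eta>_def algebra_simps)
  finally show ?thesis .
qed

subsection \<open>One step of the duality\<close>

text \<open>Completing the square turns the tilted density into a constant times the normal density
  with mean c\<sigma>^2.\<close>

lemma (in prob_space) normal_exp_moment:
  assumes \<sigma>: "\<sigma> > 0" and X: "distributed M lborel X (normal_density 0 \<sigma>)"
  shows "integrable M (\<lambda>\<omega>. exp (c * X \<omega>))" "expectation (\<lambda>\<omega>. exp (c * X \<omega>)) = exp (c^2 * \<sigma>^2 / 2)"
proof -
  have e: "normal_density 0 \<sigma> x * exp (c * x) = exp (c^2 * \<sigma>^2 / 2) * normal_density (c * \<sigma>^2) \<sigma> x" for x
  proof -
    have "- x\<^sup>2 / (2 * \<sigma>^2) + c * x = c^2 * \<sigma>^2 / 2 + (- (x - c * \<sigma>^2)\<^sup>2 / (2 * \<sigma>^2))"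
      using \<sigma> by (simp add: field_simps power2_eq_square)
    then have "exp (- x\<^sup>2 / (2 * \<sigma>^2)) * exp (c * x) = exp (c^2 * \<sigma>^2 / 2) * exp (- (x - c * \<sigma>^2)\<^sup>2 / (2 * \<sigma>^2))"
      by (simp only: exp_add[symmetric])
    then show ?thesis unfolding normal_density_def by simp
  qed
  have "integrable lborel (\<lambda>x. normal_density 0 \<sigma> x * exp (c * x))"
    unfolding e using \<sigma> by auto
  then show "integrable M (\<lambda>\<omega>. exp (c * X \<omega>))"
    by (subst (asm) distributed_integrable[OF X]) auto
  have "(\<integral>x. normal_density 0 \<sigma> x * exp (c * x) \<partial>lborel) = expectation (\<lambda>\<omega>. exp (c * X \<omega>))"
    by (rule distributed_integral[OF X]) auto
  then show "expectation (\<lambda>\<omega>. exp (c * X \<omega>)) = exp (c^2 * \<sigma>^2 / 2)"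
    unfolding e using \<sigma> by simp
qed

text \<open>The odd absolute moment is reached by interpolation: m^2 (sqrt h - |m|)^2 >= 0 bounds
  |m|^3 by the mean of sqrt h * m^2 and m^4 / sqrt h. The weights are chosen so that the orders h
  and h^2 of the even moments both become h^(3/2).\<close>

lemma (in prob_space) exp_normal_central_moments:
  assumes h: "0 < h" "h \<le> 1" and X: "distributed M lborel X (normal_density 0 (sqrt h))"
  defines "m \<equiv> \<lambda>\<omega>. exp (X \<omega> - h / 2) - 1"
  shows "integrable M m" "expectation m = 0"
    and "integrable M (\<lambda>\<omega>. m \<omega> ^ 2)" "expectation (\<lambda>\<omega>. m \<omega> ^ 2) = exp h - 1"
    and "integrable M (\<lambda>\<omega>. \<bar>m \<omega>\<bar> ^ 3)"
    and "expectation (\<lambda>\<omega>. \<bar>m \<omega>\<bar> ^ 3) \<le> (10 * exp 6) * (h * sqrt h)"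
proof -
  define z where "z k \<omega> = exp (real k * X \<omega>) * exp (-(real k * h / 2))" for k \<omega>
  have z: "integrable M (z k)" "expectation (z k) = exp (real k * (real k - 1) * h / 2)" for k
  proof -
    have *: "integrable M (\<lambda>\<omega>. exp (real k * X \<omega>))"
      "expectation (\<lambda>\<omega>. exp (real k * X \<omega>)) = exp ((real k)^2 * h / 2)"
      using normal_exp_moment[OF _ X, of "real k"] h by auto
    show "integrable M (z k)" unfolding z_def using *(1) by simp
    show "expectation (z k) = exp (real k * (real k - 1) * h / 2)"
    proof -
      have "expectation (z k) = exp ((real k)^2 * h / 2) * exp (-(real k * h / 2))"
        unfolding z_def *(2)[symmetric] by (rule integral_mult_left_zero)
      then show ?thesis unfolding exp_add[symmetric] by (simp add: field_simps power2_eq_square)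
    qed
  qed
  have zk: "(m \<omega> + 1) ^ k = z k \<omega>" for k \<omega>
    by (simp add: m_def z_def field_simps exp_diff exp_minus flip: exp_of_nat_mult exp_add)
  have m1: "m = (\<lambda>\<omega>. z 1 \<omega> - 1)" by (simp add: fun_eq_iff flip: zk)
  have m2: "m \<omega> ^ 2 = z 2 \<omega> - 2 * z 1 \<omega> + 1" for \<omega>
    unfolding zk[symmetric] by (simp add: power2_eq_square algebra_simps)
  have m4: "m \<omega> ^ 4 = z 4 \<omega> - 4 * z 3 \<omega> + 6 * z 2 \<omega> - 4 * z 1 \<omega> + 1" for \<omega>
    unfolding zk[symmetric] by (simp add: eval_nat_numeral algebra_simps)
  show "integrable M m" "expectation m = 0" unfolding m1 using z(1) by (auto simp: z(2) prob_space)
  show i2: "integrable M (\<lambda>\<omega>. m \<omega> ^ 2)" unfolding m2 using z(1) by auto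
  show e2: "expectation (\<lambda>\<omega>. m \<omega> ^ 2) = exp h - 1" unfolding m2 using z(1) by (simp add: z(2) prob_space)
  have i4: "integrable M (\<lambda>\<omega>. m \<omega> ^ 4)" unfolding m4 using z(1) by auto
  have e4: "expectation (\<lambda>\<omega>. m \<omega> ^ 4) = exp (6 * h) - 4 * exp (3 * h) + 6 * exp h - 3"
    unfolding m4 using z(1) by (simp add: z(2) prob_space)
  \<comment> \<open>In exp(6h) - 4 exp(3h) + 6 exp(h) - 3 the constant terms and the terms linear in
    h cancel, which leaves order h^2.\<close>
  have e4b: "expectation (\<lambda>\<omega>. m \<omega> ^ 4) \<le> (18 * exp 6 + 6) * h^2"
  proof -
    have "exp (6 * h) \<le> 1 + 6 * h + (6 * h)^2 / 2 * exp (6 * h)"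
      using h by (intro exp_le_second_order) auto
    also have "\<dots> \<le> 1 + 6 * h + (6 * h)^2 / 2 * exp 6"
      using h by (intro add_left_mono mult_left_mono) auto
    finally have "exp (6 * h) \<le> 1 + 6 * h + 18 * exp 6 * h^2" by (simp add: power2_eq_square mult_ac)
    moreover have "exp (3 * h) \<ge> 1 + 3 * h" by (rule exp_ge_add_one_self)
    moreover have "exp h \<le> 1 + h + h^2" using h by (intro exp_bound) auto
    moreover have "(18 * exp 6 + 6) * h^2 = 18 * exp 6 * h^2 + 6 * h^2" by (simp add: algebra_simps)
    ultimately show ?thesis unfolding e4 by linarith
  qed
  have b3: "\<bar>m \<omega>\<bar> ^ 3 \<le> (sqrt h * m \<omega> ^ 2 + m \<omega> ^ 4 / sqrt h) / 2" for \<omega>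
  proof -
    have "0 \<le> \<bar>m \<omega>\<bar>^2 * (sqrt h - \<bar>m \<omega>\<bar>)^2" by simp
    also have "\<dots> = sqrt h * (sqrt h * m \<omega> ^ 2 + m \<omega> ^ 4 / sqrt h - 2 * \<bar>m \<omega>\<bar>^3)"
      using h by (simp add: field_simps power2_eq_square power3_eq_cube power4_eq_xxxx)
    finally show ?thesis using h by (simp add: zero_le_mult_iff)
  qed
  have [measurable]: "m \<in> borel_measurable M" unfolding m1 using z(1)[of 1] by auto
  have ib: "integrable M (\<lambda>\<omega>. (sqrt h * m \<omega> ^ 2 + m \<omega> ^ 4 / sqrt h) / 2)" using i2 i4 by auto
  show i3: "integrable M (\<lambda>\<omega>. \<bar>m \<omega>\<bar> ^ 3)"
    by (rule Bochner_Integration.integrable_bound[OF ib])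
       (auto simp del: abs_divide intro!: AE_I2 order_trans[OF b3 abs_ge_self])
  have "expectation (\<lambda>\<omega>. \<bar>m \<omega>\<bar> ^ 3) \<le> expectation (\<lambda>\<omega>. (sqrt h * m \<omega> ^ 2 + m \<omega> ^ 4 / sqrt h) / 2)"
    by (intro integral_mono i3 ib b3)
  also have "\<dots> = (sqrt h * (exp h - 1) + expectation (\<lambda>\<omega>. m \<omega> ^ 4) / sqrt h) / 2"
    using i2 i4 e2 by simp
  also have "\<dots> \<le> (sqrt h * (2 * h) + (18 * exp 6 + 6) * h^2 / sqrt h) / 2"
  proof (intro divide_right_mono add_mono mult_left_mono e4b)
    have "h^2 \<le> h" using h by (simp add: power2_eq_square mult_left_le)
    then show "exp h - 1 \<le> 2 * h" using exp_bound[of h] h by simp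
  qed (use h in auto)
  also have "\<dots> = (9 * exp 6 + 4) * (h * sqrt h)"
  proof -
    have "h^2 / sqrt h = h * sqrt h"
      using h by (simp add: power2_eq_square real_div_sqrt flip: times_divide_eq_right)
    then have "(18 * exp 6 + 6) * h^2 / sqrt h = (18 * exp 6 + 6) * (h * sqrt h)"
      by (metis times_divide_eq_right)
    then show ?thesis by (simp only:) (simp add: algebra_simps)
  qed
  also have "\<dots> \<le> (10 * exp 6) * (h * sqrt h)"
  proof (intro mult_right_mono)
    show "9 * exp 6 + 4 \<le> 10 * exp (6::real)" using exp_ge_add_one_self[of "6::real"] by simp
  qed (use h in auto)
  finally show "expectation (\<lambda>\<omega>. \<bar>m \<omega>\<bar> ^ 3) \<le> (10 * exp 6) * (h * sqrt h)" .
qed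

lemma (in prob_space) abs_expectation_le:
  fixes f :: "'a \<Rightarrow> real"
  assumes "integrable M f" "\<And>\<omega>. \<bar>f \<omega>\<bar> \<le> c"
  shows "\<bar>expectation f\<bar> \<le> c"
proof -
  have "\<bar>expectation f\<bar> \<le> expectation (\<lambda>\<omega>. \<bar>f \<omega>\<bar>)" using integral_norm_bound[of M f] by simp
  also have "\<dots> \<le> expectation (\<lambda>_. c)" using assms by (intro integral_mono) auto
  finally show ?thesis by (simp add: prob_space)
qed

section \<open>The Laplace transform of Y along one step of the chain\<close>

context hyp_bessel_neg_one
begin

text \<open>$(-1)^j b^j$ times the $j$-th derivative of the Laplace transform of $Y_s$.\<close>
definition lap :: "nat \<Rightarrow> real \<Rightarrow> real \<Rightarrow> real" where
  "lap j s b = expectation (\<lambda>\<omega>. (b * Y s \<omega>) ^ j * exp (-(b * Y s \<omega>)))"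

lemma lap_measurable [measurable]:
  assumes "s \<ge> 0" shows "lap j s \<in> borel_measurable borel"
proof -
  have [measurable]: "Y s \<in> borel_measurable N" using assms by measurable
  show ?thesis unfolding lap_def[abs_def]
    by (rule borel_measurable_lebesgue_integral) measurable
qed

lemma lap_integrand:
  assumes "s \<ge> 0" "b \<ge> 0" "j \<le> 2"
  shows "integrable N (\<lambda>\<omega>. (b * Y s \<omega>) ^ j * exp (-(b * Y s \<omega>)))"
    and "0 \<le> (b * Y s \<omega>) ^ j * exp (-(b * Y s \<omega>))" and "(b * Y s \<omega>) ^ j * exp (-(b * Y s \<omega>)) \<le> 2"
proof -
  have w: "b * Y s \<omega> \<ge> 0" for \<omega> using assms Y_nonneg by simp
  have "j = 0 \<or> j = 1 \<or> j = 2" using assms by auto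
  then have b: "(b * Y s \<omega>) ^ j * exp (-(b * Y s \<omega>)) \<le> 2" for \<omega>
    using exp_neg_bounds(1,2)[OF w[of \<omega>]] w[of \<omega>] by (auto intro: order_trans[OF _ one_le_numeral])
  show "0 \<le> (b * Y s \<omega>) ^ j * exp (-(b * Y s \<omega>))" for \<omega> using w by simp
  show "(b * Y s \<omega>) ^ j * exp (-(b * Y s \<omega>)) \<le> 2" by (rule b)
  have [measurable]: "Y s \<in> borel_measurable N" using assms by measurable
  show "integrable N (\<lambda>\<omega>. (b * Y s \<omega>) ^ j * exp (-(b * Y s \<omega>)))"
  proof (rule integrable_const_bound[where B=2])
    show "AE \<omega> in N. norm ((b * Y s \<omega>) ^ j * exp (-(b * Y s \<omega>))) \<le> 2"
      using b w by (intro AE_I2) (simp add: abs_mult)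
  qed measurable
qed

lemma lap_bounds:
  assumes "s \<ge> 0" "b \<ge> 0" "j \<le> 2"
  shows "\<bar>lap j s b\<bar> \<le> 2"
proof -
  have "0 \<le> lap j s b" unfolding lap_def using lap_integrand(2)[OF assms] by (intro integral_nonneg_AE AE_I2)
  moreover have "lap j s b \<le> expectation (\<lambda>_. 2)"
    unfolding lap_def using lap_integrand[OF assms] by (intro integral_mono) auto
  ultimately show ?thesis by (simp add: prob_space)
qed

text \<open>The pointwise expansion is averaged with a = bY. Its error does not depend on a, so the
  bound is free of b, and later of the state of the chain.\<close>

lemma lap_multiplicative_taylor:
  assumes s: "s \<ge> 0" and b: "b \<ge> 0" and m: "m > -1"
  shows "\<bar>lap 0 s (b * (1 + m)) - (lap 0 s b - m * lap 1 s b + m^2 / 2 * lap 2 s b)\<bar> \<le> 24 * \<bar>m\<bar>^3"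
proof -
  let ?e = "\<lambda>j \<omega>. (b * Y s \<omega>) ^ j * exp (-(b * Y s \<omega>))"
  let ?f = "\<lambda>\<omega>. exp (-(b * (1 + m) * Y s \<omega>)) - (?e 0 \<omega> - m * ?e 1 \<omega> + m^2 / 2 * ?e 2 \<omega>)"
  have i: "integrable N (?e 0)" "integrable N (?e 1)" "integrable N (?e 2)"
    by (rule lap_integrand(1)[OF s b]; simp)+
  have b1: "b * (1 + m) \<ge> 0" using b m by simp
  have i1: "integrable N (\<lambda>\<omega>. exp (-(b * (1 + m) * Y s \<omega>)))"
    using lap_integrand(1)[OF s b1, of 0] by simp
  have ir: "integrable N (\<lambda>\<omega>. ?e 0 \<omega> - m * ?e 1 \<omega> + m^2 / 2 * ?e 2 \<omega>)"
    by (intro Bochner_Integration.integrable_add Bochner_Integration.integrable_diff integrable_mult_right i)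
  have "expectation ?f = lap 0 s (b * (1 + m)) - (lap 0 s b - m * lap 1 s b + m^2 / 2 * lap 2 s b)"
  proof -
    have "expectation ?f = expectation (\<lambda>\<omega>. exp (-(b * (1 + m) * Y s \<omega>))) -
        expectation (\<lambda>\<omega>. ?e 0 \<omega> - m * ?e 1 \<omega> + m^2 / 2 * ?e 2 \<omega>)"
      by (rule Bochner_Integration.integral_diff[OF i1 ir])
    also have "expectation (\<lambda>\<omega>. ?e 0 \<omega> - m * ?e 1 \<omega> + m^2 / 2 * ?e 2 \<omega>) =
        expectation (?e 0) - m * expectation (?e 1) + m^2 / 2 * expectation (?e 2)"
      by (subst Bochner_Integration.integral_add, intro Bochner_Integration.integrable_diff integrable_mult_right i,
          intro integrable_mult_right i, subst Bochner_Integration.integral_diff, intro i,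
          intro integrable_mult_right i, simp only: integral_mult_right_zero)
    finally show ?thesis by (simp add: lap_def)
  qed
  moreover have "\<bar>expectation ?f\<bar> \<le> 24 * \<bar>m\<bar>^3"
  proof (rule abs_expectation_le)
    show "integrable N ?f" by (intro Bochner_Integration.integrable_diff i1 ir)
    fix \<omega>
    have "b * Y s \<omega> \<ge> 0" using b Y_nonneg by simp
    from exp_multiplicative_taylor[OF this m]
    show "\<bar>?f \<omega>\<bar> \<le> 24 * \<bar>m\<bar>^3" by (simp add: mult_ac)
  qed
  ultimately show ?thesis by simp
qed

text \<open>At a frozen state x, the noise averaged to second order is compared with letting Y run
  for a further time h. The constant is 31 = 5 + 26: the first part from
  \<open>generator_one_step\<close>, the second from applying Dynkin's formula twice.\<close>

lemma lap_one_step: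
  assumes s: "s \<ge> 0" and \<beta>: "\<beta> > 0" and x: "x \<ge> 0" and h: "0 \<le> h" "h \<le> 1"
  defines "b \<equiv> \<beta> * (x / (1 + \<beta> * h * x))"
  shows "\<bar>lap 0 s b + (exp h - 1) / 2 * lap 2 s b - lap 0 (s + h) (\<beta> * x)\<bar> \<le> 31 * (h * (1 + \<beta> * x))^2"
proof -
  define c where "c = \<beta> * x"
  have c: "c \<ge> 0" using \<beta> x by (simp add: c_def)
  have b: "b \<ge> 0" unfolding b_def using \<beta> x h by simp
  let ?e = "\<lambda>j \<omega>. (b * Y s \<omega>) ^ j * exp (-(b * Y s \<omega>))"
  let ?G = "cosh_gen (\<lambda>y. c^2 * exp (-(c * y)))"
  have bg: "bounded_generator (2 + 2 * c) (\<lambda>y. exp (-(c * y))) (\<lambda>y. - c * exp (-(c * y))) (\<lambda>y. c^2 * exp (-(c * y)))"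
    by (rule bounded_generator_exp[OF c])
  note bG = bounded_generator_cosh_gen_exp[OF c]
  have Gb: "\<bar>?G y\<bar> \<le> 26 * (1 + c)^2" if "y \<ge> 0" for y
    using bG that by (auto simp: bounded_generator_def)
  have [measurable]: "?G \<in> borel_measurable borel"
    unfolding cosh_gen_def[abs_def] by measurable
  have [measurable]: "Y s \<in> borel_measurable N" using s by measurable
  have iG: "integrable N (\<lambda>\<omega>. ?G (Y s \<omega>))"
    by (rule integrable_const_bound[where B="26 * (1 + c)^2"]) (auto intro!: AE_I2 Gb Y_nonneg)
  have i: "integrable N (?e 0)" "integrable N (?e 2)" "integrable N (\<lambda>\<omega>. exp (-(c * Y s \<omega>)))"
    using lap_integrand(1)[OF s b, of 0] lap_integrand(1)[OF s b, of 2] lap_integrand(1)[OF s c, of 0] by auto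
  have L: "\<bar>lap 0 (s + h) c - lap 0 s c - h * expectation (\<lambda>\<omega>. ?G (Y s \<omega>))\<bar> \<le> 26 * (1 + c)^2 * h^2"
    using dynkin_second_order[OF bg bG s h(1)] by (simp add: lap_def)
  let ?f = "\<lambda>\<omega>. (?e 0 \<omega> + (exp h - 1) / 2 * ?e 2 \<omega>) - exp (-(c * Y s \<omega>)) - h * ?G (Y s \<omega>)"
  have ii: "integrable N (\<lambda>\<omega>. ?e 0 \<omega> + (exp h - 1) / 2 * ?e 2 \<omega>)"
    "integrable N (\<lambda>\<omega>. (?e 0 \<omega> + (exp h - 1) / 2 * ?e 2 \<omega>) - exp (-(c * Y s \<omega>)))"
    "integrable N (\<lambda>\<omega>. h * ?G (Y s \<omega>))" "integrable N (\<lambda>\<omega>. (exp h - 1) / 2 * ?e 2 \<omega>)"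
    by (intro Bochner_Integration.integrable_add Bochner_Integration.integrable_diff integrable_mult_right i iG)+
  have "expectation ?f = (lap 0 s b + (exp h - 1) / 2 * lap 2 s b) - lap 0 s c - h * expectation (\<lambda>\<omega>. ?G (Y s \<omega>))"
  proof -
    have "expectation ?f = expectation (?e 0) + (exp h - 1) / 2 * expectation (?e 2) - expectation (\<lambda>\<omega>. exp (-(c * Y s \<omega>)))
        - h * expectation (\<lambda>\<omega>. ?G (Y s \<omega>))"
      unfolding Bochner_Integration.integral_diff[OF ii(2,3)] Bochner_Integration.integral_diff[OF ii(1) i(3)]
        Bochner_Integration.integral_add[OF i(1) ii(4)] integral_mult_right_zero ..
    then show ?thesis by (simp add: lap_def)
  qed
  moreover have "\<bar>expectation ?f\<bar> \<le> 5 * (h * (1 + c))^2"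
  proof (rule abs_expectation_le)
    show "integrable N ?f" by (intro Bochner_Integration.integrable_diff ii)
    fix \<omega>
    show "\<bar>?f \<omega>\<bar> \<le> 5 * (h * (1 + c))^2"
      using generator_one_step[OF \<beta> x Y_nonneg h, of s \<omega>] by (simp add: b_def c_def)
  qed
  ultimately have "\<bar>lap 0 s b + (exp h - 1) / 2 * lap 2 s b - lap 0 (s + h) c\<bar> \<le> 5 * (h * (1 + c))^2 + 26 * (1 + c)^2 * h^2"
    using L by linarith
  also have "5 * (h * (1 + c))^2 + 26 * (1 + c)^2 * h^2 = 31 * (h * (1 + c))^2"
    by (simp add: power_mult_distrib)
  finally show ?thesis by (simp add: c_def)
qed

text \<open>The expansion in m separates state and noise into products of independent factors. The
  linear term vanishes because m is centred, and m^2 averages to exp h - 1, which is exactly the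
  combination treated in \<open>lap_one_step\<close>.\<close>

lemma lap_chain_step:
  fixes M :: "'a measure" and X m :: "'a \<Rightarrow> real"
  assumes M: "prob_space M" and s: "s \<ge> 0" and \<beta>: "\<beta> > 0" and h: "0 \<le> h" "h \<le> 1"
    and X: "\<And>\<omega>. X \<omega> \<ge> 0" and m: "\<And>\<omega>. m \<omega> > -1"
    and indep: "prob_space.indep_var M borel X borel m"
    and m1: "integrable M m" "(\<integral>\<omega>. m \<omega> \<partial>M) = 0"
    and m2: "integrable M (\<lambda>\<omega>. m \<omega> ^ 2)" "(\<integral>\<omega>. m \<omega> ^ 2 \<partial>M) = exp h - 1"
    and m3: "integrable M (\<lambda>\<omega>. \<bar>m \<omega>\<bar> ^ 3)"
    and X2: "integrable M (\<lambda>\<omega>. (1 + \<beta> * X \<omega>)^2)"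
  shows "\<bar>(\<integral>\<omega>. lap 0 s (\<beta> * (X \<omega> / (1 + \<beta> * h * X \<omega>) * (1 + m \<omega>))) \<partial>M) - (\<integral>\<omega>. lap 0 (s + h) (\<beta> * X \<omega>) \<partial>M)\<bar>
    \<le> 24 * (\<integral>\<omega>. \<bar>m \<omega>\<bar> ^ 3 \<partial>M) + 31 * h^2 * (\<integral>\<omega>. (1 + \<beta> * X \<omega>)^2 \<partial>M)"
proof -
  interpret M: prob_space M by (rule M)
  \<comment> \<open>This is \<beta> times the state after the drift and before the noise.\<close>
  define \<kappa> where "\<kappa> x = \<beta> * (x / (1 + \<beta> * h * x))" for x
  have [measurable]: "\<kappa> \<in> borel_measurable borel" unfolding \<kappa>_def[abs_def] by measurable
  have [measurable]: "X \<in> borel_measurable M" "m \<in> borel_measurable M"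
    using M.indep_var_rv1[OF indep] M.indep_var_rv2[OF indep] by auto
  have [measurable]: "lap j s \<in> borel_measurable borel" "lap j (s + h) \<in> borel_measurable borel" for j
    using s h by (auto intro: lap_measurable)
  have \<kappa>: "\<kappa> (X \<omega>) \<ge> 0" for \<omega> unfolding \<kappa>_def using \<beta> h X by simp
  have "1 + m \<omega> \<ge> 0" for \<omega> using m[of \<omega>] by simp
  then have \<kappa>m: "\<kappa> (X \<omega>) * (1 + m \<omega>) \<ge> 0" for \<omega> using \<kappa> by simp
  have iL: "integrable M (\<lambda>\<omega>. lap j s (\<kappa> (X \<omega>)))" if "j \<le> 2" for j
    using lap_bounds[OF s \<kappa> that] by (intro M.integrable_const_bound[where B=2]) auto
  have iLm: "integrable M (\<lambda>\<omega>. lap 0 s (\<kappa> (X \<omega>) * (1 + m \<omega>)))"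
    using lap_bounds[OF s \<kappa>m, of 0] by (intro M.integrable_const_bound[where B=2]) auto
  have iLh: "integrable M (\<lambda>\<omega>. lap 0 (s + h) (\<beta> * X \<omega>))"
    using lap_bounds[of "s + h" "\<beta> * X _" 0] s h \<beta> X by (intro M.integrable_const_bound[where B=2]) auto
  have ind: "M.indep_var borel (\<lambda>\<omega>. lap j s (\<kappa> (X \<omega>))) borel (\<lambda>\<omega>. m \<omega> ^ k)" for j k
    using M.indep_var_compose[OF indep, of "\<lambda>x. lap j s (\<kappa> x)" borel "\<lambda>x. x ^ k" borel]
    by (simp add: comp_def)
  have p1: "integrable M (\<lambda>\<omega>. lap 1 s (\<kappa> (X \<omega>)) * m \<omega>)"
    "(\<integral>\<omega>. lap 1 s (\<kappa> (X \<omega>)) * m \<omega> \<partial>M) = 0"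
    using M.indep_var_integrable[OF ind[of 1 1]] M.indep_var_lebesgue_integral[OF ind[of 1 1]] iL[of 1] m1 by auto
  have p2: "integrable M (\<lambda>\<omega>. lap 2 s (\<kappa> (X \<omega>)) * m \<omega> ^ 2)"
    "(\<integral>\<omega>. lap 2 s (\<kappa> (X \<omega>)) * m \<omega> ^ 2 \<partial>M) = (\<integral>\<omega>. lap 2 s (\<kappa> (X \<omega>)) \<partial>M) * (exp h - 1)"
    using M.indep_var_integrable[OF ind[of 2 2]] M.indep_var_lebesgue_integral[OF ind[of 2 2]] iL[of 2] m2 by auto
  let ?A = "\<lambda>\<omega>. lap 0 s (\<kappa> (X \<omega>) * (1 + m \<omega>))"
  let ?T = "\<lambda>\<omega>. lap 0 s (\<kappa> (X \<omega>)) - lap 1 s (\<kappa> (X \<omega>)) * m \<omega> + lap 2 s (\<kappa> (X \<omega>)) * m \<omega> ^ 2 / 2"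
  let ?Q = "\<lambda>\<omega>. lap 0 s (\<kappa> (X \<omega>)) + (exp h - 1) / 2 * lap 2 s (\<kappa> (X \<omega>))"
  have iT: "integrable M ?T" and iQ: "integrable M ?Q" using p1 p2 iL by auto
  have TQ: "(\<integral>\<omega>. ?T \<omega> \<partial>M) = (\<integral>\<omega>. ?Q \<omega> \<partial>M)" using p1 p2 iL by simp
  have "\<bar>(\<integral>\<omega>. ?A \<omega> \<partial>M) - (\<integral>\<omega>. ?T \<omega> \<partial>M)\<bar> = \<bar>\<integral>\<omega>. ?A \<omega> - ?T \<omega> \<partial>M\<bar>"
    using iLm iT by (subst Bochner_Integration.integral_diff) auto
  also have "\<dots> \<le> (\<integral>\<omega>. \<bar>?A \<omega> - ?T \<omega>\<bar> \<partial>M)" using integral_norm_bound[of M "\<lambda>\<omega>. ?A \<omega> - ?T \<omega>"] by simp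
  also have "\<dots> \<le> (\<integral>\<omega>. 24 * \<bar>m \<omega>\<bar> ^ 3 \<partial>M)"
  proof (rule integral_mono)
    show "integrable M (\<lambda>\<omega>. \<bar>?A \<omega> - ?T \<omega>\<bar>)" using iLm iT by (intro integrable_abs Bochner_Integration.integrable_diff)
    show "integrable M (\<lambda>\<omega>. 24 * \<bar>m \<omega>\<bar> ^ 3)" using m3 by simp
    show "\<bar>?A \<omega> - ?T \<omega>\<bar> \<le> 24 * \<bar>m \<omega>\<bar> ^ 3" for \<omega>
      using lap_multiplicative_taylor[OF s \<kappa> m, of \<omega> \<omega>] by (simp add: mult_ac)
  qed
  finally have S1: "\<bar>(\<integral>\<omega>. ?A \<omega> \<partial>M) - (\<integral>\<omega>. ?T \<omega> \<partial>M)\<bar> \<le> 24 * (\<integral>\<omega>. \<bar>m \<omega>\<bar> ^ 3 \<partial>M)" by simp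
  let ?V = "\<lambda>\<omega>. lap 0 (s + h) (\<beta> * X \<omega>)"
  have "\<bar>(\<integral>\<omega>. ?Q \<omega> \<partial>M) - (\<integral>\<omega>. ?V \<omega> \<partial>M)\<bar> = \<bar>\<integral>\<omega>. ?Q \<omega> - ?V \<omega> \<partial>M\<bar>"
    using iLh iQ by (subst Bochner_Integration.integral_diff) auto
  also have "\<dots> \<le> (\<integral>\<omega>. \<bar>?Q \<omega> - ?V \<omega>\<bar> \<partial>M)" using integral_norm_bound[of M "\<lambda>\<omega>. ?Q \<omega> - ?V \<omega>"] by simp
  also have "\<dots> \<le> (\<integral>\<omega>. 31 * h^2 * (1 + \<beta> * X \<omega>)^2 \<partial>M)"
  proof (rule integral_mono)
    show "integrable M (\<lambda>\<omega>. \<bar>?Q \<omega> - ?V \<omega>\<bar>)" using iLh iQ by (intro integrable_abs Bochner_Integration.integrable_diff)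
    show "integrable M (\<lambda>\<omega>. 31 * h^2 * (1 + \<beta> * X \<omega>)^2)" using X2 by simp
    show "\<bar>?Q \<omega> - ?V \<omega>\<bar> \<le> 31 * h^2 * (1 + \<beta> * X \<omega>)^2" for \<omega>
      using lap_one_step[OF s \<beta> X h, of \<omega>] by (simp add: \<kappa>_def power_mult_distrib)
  qed
  finally have S2: "\<bar>(\<integral>\<omega>. ?Q \<omega> \<partial>M) - (\<integral>\<omega>. ?V \<omega> \<partial>M)\<bar> \<le> 31 * h^2 * (\<integral>\<omega>. (1 + \<beta> * X \<omega>)^2 \<partial>M)" by simp
  have "(\<integral>\<omega>. lap 0 s (\<beta> * (X \<omega> / (1 + \<beta> * h * X \<omega>) * (1 + m \<omega>))) \<partial>M) = (\<integral>\<omega>. ?A \<omega> \<partial>M)"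
    by (simp add: \<kappa>_def mult.assoc)
  then show ?thesis using S1 S2 TQ by linarith
qed

end

subsection \<open>The discretised process and the limit\<close>

text \<open>Here $z$ lists the Brownian increments over a grid of mesh $h$.\<close>
fun discrete_gamma :: "real \<Rightarrow> real \<Rightarrow> nat \<Rightarrow> (nat \<Rightarrow> real) \<Rightarrow> real" where
  "discrete_gamma \<beta> h 0 z = 1"
| "discrete_gamma \<beta> h (Suc k) z =
     discrete_gamma \<beta> h k z / (1 + \<beta> * h * discrete_gamma \<beta> h k z) * exp (z k - h / 2)"

text \<open>The index set I stays fixed while k grows, so the induction hypothesis speaks of the
  same product space.\<close>

lemma discrete_gamma_measurable:
  assumes "{..<k} \<subseteq> I"
  shows "discrete_gamma \<beta> h k \<in> borel_measurable (Pi\<^sub>M I (\<lambda>_. borel))"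
  using assms
proof (induction k)
  case 0
  then show ?case by simp
next
  case (Suc k)
  have [measurable]: "discrete_gamma \<beta> h k \<in> borel_measurable (Pi\<^sub>M I (\<lambda>_. borel))"
    using Suc.IH Suc.prems by (simp add: lessThan_Suc)
  have [measurable]: "(\<lambda>z. z k) \<in> borel_measurable (Pi\<^sub>M I (\<lambda>_. borel))"
    using Suc.prems by (intro measurable_component_singleton) auto
  show ?case by simp
qed

lemma discrete_gamma_cong:
  "(\<And>i. i < k \<Longrightarrow> z i = z' i) \<Longrightarrow> discrete_gamma \<beta> h k z = discrete_gamma \<beta> h k z'"
  by (induction k) auto

text \<open>The recursion is affine in the reciprocal: 1/X_{k+1} = (1/X_k + \<beta>h) exp(-(z_k -
  h/2)). Hence the denominators accumulate the left Riemann sum, while the exponentials telescope to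
  the Brownian path.\<close>

lemma discrete_gamma_closed_form:
  assumes \<beta>: "\<beta> > 0" and h: "h \<ge> 0" and b0: "b 0 = 0"
  shows "discrete_gamma \<beta> h k (\<lambda>i. b (real (Suc i) * h) - b (real i * h)) =
    exp (b (real k * h) - real k * h / 2) / (1 + \<beta> * h * (\<Sum>i<k. exp (b (real i * h) - real i * h / 2)))"
proof (induction k)
  case 0
  then show ?case using b0 by simp
next
  case (Suc k)
  let ?e = "exp (b (real k * h) - real k * h / 2)"
  let ?D = "1 + \<beta> * h * (\<Sum>i<k. exp (b (real i * h) - real i * h / 2))"
  have D: "?D > 0" using \<beta> h by (intro add_pos_nonneg mult_nonneg_nonneg sum_nonneg) auto
  have e1: "?e / ?D / (1 + \<beta> * h * (?e / ?D)) = ?e / (?D + \<beta> * h * ?e)"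
  proof -
    have "?D * (1 + \<beta> * h * (?e / ?D)) = ?D + \<beta> * h * ?e" using D by (simp add: distrib_left)
    then show ?thesis by (simp only: divide_divide_eq_left)
  qed
  have e2: "?D + \<beta> * h * ?e = 1 + \<beta> * h * (\<Sum>i<Suc k. exp (b (real i * h) - real i * h / 2))"
    by (simp add: algebra_simps)
  have e3: "?e * exp (b (real (Suc k) * h) - b (real k * h) - h / 2) =
      exp (b (real (Suc k) * h) - real (Suc k) * h / 2)"
  proof -
    have "real (Suc k) * h / 2 = real k * h / 2 + h / 2" by (simp add: field_simps)
    then show ?thesis unfolding exp_add[symmetric] by (intro arg_cong[where f=exp]) linarith
  qed
  show ?case unfolding discrete_gamma.simps Suc.IH by (simp only: e1 e2 e3 times_divide_eq_left)
qed

section \<open>Telescoping over the grid and refining the mesh\<close>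

context hyp_bessel_neg_one
begin

text \<open>Each of the n steps costs a multiple of h sqrt h, and nh = t. In the constant, 240 = 24
  * 10 combines the Taylor error with the third moment, and 62 = 31 * 2 combines the one-step error
  with E(1 + \<beta>X_k)^2 <= 2(1 + \<beta>^2 exp t). The condition t <= n makes h <= 1.\<close>

lemma discretised_duality:
  fixes M :: "'a measure" and B :: "real \<Rightarrow> 'a \<Rightarrow> real"
  assumes bm: "brownian_motion M B" and \<beta>: "\<beta> > 0" and t: "t > 0" and n: "n \<ge> 1" and tn: "t \<le> real n"
  defines "h \<equiv> t / real n"
  shows "\<bar>(\<integral>\<omega>. exp (- \<beta> * (cosh r0 - 1) * (exp (B t \<omega> - t / 2) /
      (1 + \<beta> * (h * (\<Sum>i<n. exp (B (real i * h) \<omega> - real i * h / 2)))))) \<partial>M) - lap 0 t \<beta>\<bar>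
    \<le> (240 * exp 6 + 62 * (1 + \<beta>^2 * exp t)) * t * sqrt h"
proof -
  interpret M: prob_space M using bm by (simp add: brownian_motion_def)
  have h: "0 < h" "h \<le> 1" "real n * h = t" using t n tn by (auto simp: h_def)
  have B0: "B 0 \<omega> = 0" if "\<omega> \<in> space M" for \<omega> using bm that by (simp add: brownian_motion_def)
  have Bm [measurable]: "B s \<in> borel_measurable M" if "s \<ge> 0" for s using bm that by (simp add: brownian_motion_def)
  define \<xi> where "\<xi> i \<omega> = B (real (Suc i) * h) \<omega> - B (real i * h) \<omega>" for i \<omega>
  have \<xi>m [measurable]: "\<xi> i \<in> borel_measurable M" for i
    unfolding \<xi>_def[abs_def] using h by (intro borel_measurable_diff Bm) auto
  have \<xi>d: "distributed M lborel (\<xi> i) (normal_density 0 (sqrt h))" for i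
  proof -
    have "0 \<le> real i * h \<and> real i * h < real (Suc i) * h" using h by (simp add: algebra_simps)
    then have "distributed M lborel (\<lambda>\<omega>. B (real (Suc i) * h) \<omega> - B (real i * h) \<omega>)
        (normal_density 0 (sqrt (real (Suc i) * h - real i * h)))"
      using bm unfolding brownian_motion_def by blast
    moreover have "real (Suc i) * h - real i * h = h" by (simp add: algebra_simps)
    ultimately show ?thesis by (simp add: \<xi>_def[abs_def])
  qed
  have ind: "M.indep_vars (\<lambda>_. borel) \<xi> {..<n}"
  proof -
    \<comment> \<open>The grid has n + 1 points, hence n increments, matching
      \<open>length ts - 1\<close>.\<close>
    define ts where "ts = map (\<lambda>i. real i * h) [0..<Suc n]"
    have "sorted ts" unfolding ts_def
      using h by (auto simp: sorted_iff_nth_mono nth_append intro!: mult_right_mono simp del: upt_Suc)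
    moreover have "\<forall>x\<in>set ts. 0 \<le> x" using h by (auto simp: ts_def)
    ultimately have "M.indep_vars (\<lambda>_. borel) (\<lambda>i \<omega>. B (ts ! Suc i) \<omega> - B (ts ! i) \<omega>) {..<length ts - 1}"
      using bm unfolding brownian_motion_def by blast
    then show ?thesis
      by (subst M.indep_vars_cong[where Y="\<lambda>i \<omega>. B (ts ! Suc i) \<omega> - B (ts ! i) \<omega>" and J="{..<length ts - 1}"])
         (auto simp: ts_def \<xi>_def[abs_def] simp del: upt_Suc)
  qed
  define X where "X k \<omega> = discrete_gamma \<beta> h k (\<lambda>i. \<xi> i \<omega>)" for k \<omega>
  define m where "m k \<omega> = exp (\<xi> k \<omega> - h / 2) - 1" for k \<omega>
  have X0: "X k \<omega> \<ge> 0" for k \<omega>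
    unfolding X_def using \<beta> h by (induction k) auto
  have XS: "X (Suc k) \<omega> = X k \<omega> / (1 + \<beta> * h * X k \<omega>) * (1 + m k \<omega>)" for k \<omega>
    by (simp add: X_def m_def)
  have Xm [measurable]: "X k \<in> borel_measurable M" for k
  proof (induction k)
    case 0 then show ?case by (simp add: X_def[abs_def])
  next
    case (Suc k) then show ?case unfolding XS[abs_def] m_def by measurable
  qed
  have Xc: "X k \<omega> = exp (B (real k * h) \<omega> - real k * h / 2) /
      (1 + \<beta> * h * (\<Sum>i<k. exp (B (real i * h) \<omega> - real i * h / 2)))" if "\<omega> \<in> space M" for k \<omega>
    unfolding X_def \<xi>_def using discrete_gamma_closed_form[of \<beta> h "\<lambda>s. B s \<omega>" k] \<beta> h B0[OF that] by simp
  have indX: "M.indep_var borel (X k) borel (m k)" if "k < n" for k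
  proof -
    \<comment> \<open>The state X_k is a function of the increments with index below k, the noise
      m_k of the increment k alone: disjoint blocks of an independent family.\<close>
    have "M.indep_var (Pi\<^sub>M {..<k} (\<lambda>_. borel)) (\<lambda>\<omega>. restrict (\<lambda>i. \<xi> i \<omega>) {..<k})
        (Pi\<^sub>M {k} (\<lambda>_. borel)) (\<lambda>\<omega>. restrict (\<lambda>i. \<xi> i \<omega>) {k})"
      using that by (intro M.indep_var_restrict[OF ind]) auto
    from M.indep_var_compose[OF this, of "discrete_gamma \<beta> h k" borel "\<lambda>z. exp (z k - h / 2) - 1" borel]
    have "M.indep_var borel (discrete_gamma \<beta> h k \<circ> (\<lambda>\<omega>. restrict (\<lambda>i. \<xi> i \<omega>) {..<k}))
        borel ((\<lambda>z. exp (z k - h / 2) - 1) \<circ> (\<lambda>\<omega>. restrict (\<lambda>i. \<xi> i \<omega>) {k}))"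
      by (simp add: discrete_gamma_measurable)
    moreover have "discrete_gamma \<beta> h k \<circ> (\<lambda>\<omega>. restrict (\<lambda>i. \<xi> i \<omega>) {..<k}) = X k"
      by (auto simp: fun_eq_iff X_def intro!: discrete_gamma_cong)
    moreover have "(\<lambda>z. exp (z k - h / 2) - 1) \<circ> (\<lambda>\<omega>. restrict (\<lambda>i. \<xi> i \<omega>) {k}) = m k"
      by (auto simp: fun_eq_iff m_def)
    ultimately show ?thesis by simp
  qed
  have sq: "integrable M (\<lambda>\<omega>. (1 + \<beta> * X k \<omega>)^2)" "(\<integral>\<omega>. (1 + \<beta> * X k \<omega>)^2 \<partial>M) \<le> 2 * (1 + \<beta>^2 * exp t)"
    if k: "k \<le> n" for k
  proof -
    define u where "u = real k * h"
    have u: "0 \<le> u" "u \<le> t" unfolding u_def using h k by (auto simp flip: h(3))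
    let ?z = "\<lambda>\<omega>. exp (2 * B u \<omega>) * exp (-u)"
    have z: "integrable M ?z" "(\<integral>\<omega>. ?z \<omega> \<partial>M) = exp u"
    proof -
      have *: "integrable M (\<lambda>\<omega>. exp (2 * B u \<omega>)) \<and> (\<integral>\<omega>. exp (2 * B u \<omega>) \<partial>M) = exp (2 * u)"
      \<comment> \<open>Increments carry a normal density only over intervals of positive length, so
        the initial grid point is treated apart.\<close>
      proof (cases "u = 0")
        case True
        have "integrable M (\<lambda>\<omega>. exp (2 * B u \<omega>)) \<longleftrightarrow> integrable M (\<lambda>_. 1::real)"
          by (rule Bochner_Integration.integrable_cong) (auto simp: True B0)
        moreover have "(\<integral>\<omega>. exp (2 * B u \<omega>) \<partial>M) = (\<integral>\<omega>. 1 \<partial>M)"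
          by (rule Bochner_Integration.integral_cong) (auto simp: True B0)
        ultimately show ?thesis by (simp add: True M.prob_space)
      next
        case False
        have "distributed M lborel (\<lambda>\<omega>. B u \<omega> - B 0 \<omega>) (normal_density 0 (sqrt (u - 0)))"
          using bm u False unfolding brownian_motion_def by (metis less_eq_real_def order_refl)
        then have d: "distributed M lborel (\<lambda>\<omega>. B u \<omega> - B 0 \<omega>) (normal_density 0 (sqrt u))" by simp
        note n = M.normal_exp_moment[OF _ d, of 2]
        have "integrable M (\<lambda>\<omega>. exp (2 * B u \<omega>)) \<longleftrightarrow> integrable M (\<lambda>\<omega>. exp (2 * (B u \<omega> - B 0 \<omega>)))"
          by (rule Bochner_Integration.integrable_cong) (auto simp: B0)
        moreover have "(\<integral>\<omega>. exp (2 * B u \<omega>) \<partial>M) = (\<integral>\<omega>. exp (2 * (B u \<omega> - B 0 \<omega>)) \<partial>M)"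
          by (rule Bochner_Integration.integral_cong) (auto simp: B0)
        ultimately show ?thesis using n u False by simp
      qed
      then show "integrable M ?z" by simp
      have "(\<integral>\<omega>. ?z \<omega> \<partial>M) = exp (2 * u) * exp (-u)" using * by simp
      then show "(\<integral>\<omega>. ?z \<omega> \<partial>M) = exp u" by (simp flip: exp_add)
    qed
    \<comment> \<open>The denominator is at least 1, so X_k is dominated by exp(B_u - u/2), whose
      square has mean exp u. Combined with (1 + a)^2 <= 2 + 2a^2 this gives the bound.\<close>
    have b: "(1 + \<beta> * X k \<omega>)^2 \<le> 2 + 2 * \<beta>^2 * ?z \<omega>" if \<omega>: "\<omega> \<in> space M" for \<omega>
    proof -
      have "1 \<le> 1 + \<beta> * h * (\<Sum>i<k. exp (B (real i * h) \<omega> - real i * h / 2))"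
        using \<beta> h by (simp add: sum_nonneg)
      then have "X k \<omega> \<le> exp (B u \<omega> - u / 2)"
        unfolding Xc[OF \<omega>] u_def by (simp add: divide_le_eq mult_le_cancel_left1)
      then have "(X k \<omega>)^2 \<le> (exp (B u \<omega> - u / 2))^2" using X0 by (intro power_mono) auto
      also have "\<dots> = ?z \<omega>" by (simp add: power2_eq_square flip: exp_add)
      finally have "\<beta>^2 * (X k \<omega>)^2 \<le> \<beta>^2 * ?z \<omega>" by (intro mult_left_mono) auto
      moreover have "(1 + \<beta> * X k \<omega>)^2 \<le> 2 + 2 * (\<beta>^2 * (X k \<omega>)^2)"
        using zero_le_power2[of "1 - \<beta> * X k \<omega>"] by (simp add: power2_eq_square algebra_simps)
      ultimately show ?thesis by (simp add: mult.assoc)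
    qed
    have iz: "integrable M (\<lambda>\<omega>. 2 + 2 * \<beta>^2 * ?z \<omega>)" using z(1) by auto
    show i: "integrable M (\<lambda>\<omega>. (1 + \<beta> * X k \<omega>)^2)"
      by (rule Bochner_Integration.integrable_bound[OF iz]) (auto intro!: AE_I2 b order_trans[OF b abs_ge_self])
    have "(\<integral>\<omega>. (1 + \<beta> * X k \<omega>)^2 \<partial>M) \<le> (\<integral>\<omega>. 2 + 2 * \<beta>^2 * ?z \<omega> \<partial>M)"
      by (intro integral_mono i iz b)
    also have "\<dots> = 2 + 2 * \<beta>^2 * exp u"
    proof -
      have "integrable M (\<lambda>\<omega>. 2 * \<beta>^2 * ?z \<omega>)" using z(1) by (rule integrable_mult_right)
      then have "(\<integral>\<omega>. 2 + 2 * \<beta>^2 * ?z \<omega> \<partial>M) = (\<integral>\<omega>. 2 \<partial>M) + 2 * \<beta>^2 * (\<integral>\<omega>. ?z \<omega> \<partial>M)"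
        unfolding integral_mult_right_zero[symmetric] by (intro Bochner_Integration.integral_add) auto
      then show ?thesis unfolding z(2) by (simp add: M.prob_space)
    qed
    also have "\<dots> \<le> 2 + 2 * \<beta>^2 * exp t" using u by (intro add_left_mono mult_left_mono) auto
    finally show "(\<integral>\<omega>. (1 + \<beta> * X k \<omega>)^2 \<partial>M) \<le> 2 * (1 + \<beta>^2 * exp t)" by simp
  qed
  define C where "C = 240 * exp 6 + 62 * (1 + \<beta>^2 * exp t)"
  define e where "e k = (\<integral>\<omega>. lap 0 (t - real k * h) (\<beta> * X k \<omega>) \<partial>M)" for k
  have step: "\<bar>e (Suc k) - e k\<bar> \<le> C * (h * sqrt h)" if k: "k < n" for k
  proof -
    \<comment> \<open>This is the time left for Y after the step; before it, s + h was left.\<close>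
    define s where "s = t - real (Suc k) * h"
    have "real (Suc k) * h \<le> real n * h" using k h by (intro mult_right_mono) auto
    then have s: "s \<ge> 0" using h by (simp add: s_def)
    have sh: "s + h = t - real k * h" by (simp add: s_def algebra_simps)
    note mm = M.exp_normal_central_moments[OF h(1,2) \<xi>d[of k], folded m_def]
    have m1: "m k \<omega> > -1" for \<omega> by (simp add: m_def)
    have "\<bar>e (Suc k) - e k\<bar> \<le> 24 * (\<integral>\<omega>. \<bar>m k \<omega>\<bar> ^ 3 \<partial>M) + 31 * h^2 * (\<integral>\<omega>. (1 + \<beta> * X k \<omega>)^2 \<partial>M)"
      using lap_chain_step[OF M.prob_space_axioms s \<beta> less_imp_le[OF h(1)] h(2) X0 m1 indX[OF k] mm(1-5) sq(1)] k
      unfolding e_def XS sh s_def[symmetric] by simp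
    also have "\<dots> \<le> 24 * (10 * exp 6 * (h * sqrt h)) + 31 * (h * sqrt h) * (2 * (1 + \<beta>^2 * exp t))"
    \<comment> \<open>Since h <= 1, the h^2 error of the generator is absorbed into the order h sqrt
      h of the cubic moment.\<close>
    proof (intro add_mono mult_left_mono mult_mono mm(6) sq(2))
      have "sqrt h \<le> 1" using h by simp
      then have "sqrt h * sqrt h \<le> 1 * sqrt h" using h by (intro mult_right_mono) auto
      then have "h \<le> sqrt h" using h by simp
      then show "h^2 \<le> h * sqrt h" using h by (simp add: power2_eq_square)
    qed (use h k in auto)
    also have "\<dots> = C * (h * sqrt h)" by (simp add: C_def algebra_simps)
    finally show ?thesis .
  qed
  have tel: "\<bar>e k - e 0\<bar> \<le> real k * (C * (h * sqrt h))" if "k \<le> n" for k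
    using that
  proof (induction k)
    case (Suc k)
    then have "\<bar>e k - e 0\<bar> \<le> real k * (C * (h * sqrt h))" "\<bar>e (Suc k) - e k\<bar> \<le> C * (h * sqrt h)"
      using step[of k] by auto
    moreover have "real (Suc k) * (C * (h * sqrt h)) = real k * (C * (h * sqrt h)) + C * (h * sqrt h)"
      by (simp add: algebra_simps)
    ultimately show ?case by linarith
  qed simp
  have "e 0 = lap 0 t \<beta>" by (simp add: e_def X_def M.prob_space)
  moreover have "e n = (\<integral>\<omega>. exp (- \<beta> * (cosh r0 - 1) * (exp (B t \<omega> - t / 2) /
      (1 + \<beta> * (h * (\<Sum>i<n. exp (B (real i * h) \<omega> - real i * h / 2)))))) \<partial>M)"
  proof -
    have l0: "lap 0 0 b = exp (-(b * (cosh r0 - 1)))" for b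
    proof -
      have "lap 0 0 b = expectation (\<lambda>\<omega>. exp (-(b * (cosh r0 - 1))))"
        unfolding lap_def by (rule Bochner_Integration.integral_cong) (auto simp: Y_zero)
      then show ?thesis by (simp add: prob_space)
    qed
    show ?thesis unfolding e_def h(3) diff_self l0
      by (rule Bochner_Integration.integral_cong) (auto simp: Xc h(3) mult.assoc mult.left_commute[of _ \<beta>] mult.commute[of _ "cosh r0 - 1"])
  qed
  moreover have "real n * (C * (h * sqrt h)) = C * t * sqrt h" unfolding h(3)[symmetric] by simp
  ultimately show ?thesis using tel[of n] unfolding C_def by (simp only: order_refl)
qed

text \<open>The right side of the discretised identity does not depend on n. On the left the
  integrands lie between 0 and 1 and converge pathwise, so dominated convergence identifies the
  limit.\<close>

lemma duality:
  fixes M :: "'a measure" and B :: "real \<Rightarrow> 'a \<Rightarrow> real"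
  assumes bm: "brownian_motion M B" and \<beta>: "\<beta> > 0" and t: "t > 0"
  shows "(\<integral>\<omega>. exp (- \<beta> * (cosh r0 - 1) * (exp (B t \<omega> - t / 2) /
      (1 + \<beta> * integral {0..t} (\<lambda>s. exp (B s \<omega> - s / 2))))) \<partial>M) = lap 0 t \<beta>"
proof -
  interpret M: prob_space M using bm by (simp add: brownian_motion_def)
  define c where "c = \<beta> * (cosh r0 - 1)"
  have c: "c \<ge> 0" using \<beta> by (simp add: c_def cosh_real_ge_1)
  have Bm [measurable]: "B s \<in> borel_measurable M" if "s \<ge> 0" for s using bm that by (simp add: brownian_motion_def)
  define S where "S n \<omega> = t / real n * (\<Sum>i<n. exp (B (real i * (t / real n)) \<omega> - real i * (t / real n) / 2))" for n \<omega>
  define J where "J \<omega> = integral {0..t} (\<lambda>s. exp (B s \<omega> - s / 2))" for \<omega>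
  define \<phi> where "\<phi> a \<omega> = exp (- c * (exp (B t \<omega> - t / 2) / (1 + \<beta> * a)))" for a \<omega>
  have S0: "S n \<omega> \<ge> 0" for n \<omega> unfolding S_def using t by (simp add: sum_nonneg)
  have Slim: "(\<lambda>n. S n \<omega>) \<longlonglongrightarrow> J \<omega>" if \<omega>: "\<omega> \<in> space M" for \<omega>
  proof -
    have "continuous_on {0..} (\<lambda>s. B s \<omega>)" using bm \<omega> by (simp add: brownian_motion_def)
    then have "continuous_on {0..0 + t} (\<lambda>s. exp (B s \<omega> - s / 2))"
      by (intro continuous_intros) (auto elim: continuous_on_subset)
    from riemann_sum_tendsto[OF this] show ?thesis using t by (simp add: S_def J_def)
  qed
  have [measurable]: "S n \<in> borel_measurable M" for n
    unfolding S_def[abs_def] using t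
    by (intro borel_measurable_times borel_measurable_sum borel_measurable_const) (auto intro!: measurable_compose[OF _ borel_measurable_exp] borel_measurable_diff Bm)
  have [measurable]: "J \<in> borel_measurable M" by (rule borel_measurable_LIMSEQ_real[OF Slim]) auto
  have [measurable]: "B t \<in> borel_measurable M" using t by (intro Bm) auto
  have lim: "(\<lambda>n. \<integral>\<omega>. \<phi> (S n \<omega>) \<omega> \<partial>M) \<longlonglongrightarrow> (\<integral>\<omega>. \<phi> (J \<omega>) \<omega> \<partial>M)"
  proof (rule integral_dominated_convergence[where w="\<lambda>_. 1"])
    show "(\<lambda>\<omega>. \<phi> (J \<omega>) \<omega>) \<in> borel_measurable M" "(\<lambda>\<omega>. \<phi> (S n \<omega>) \<omega>) \<in> borel_measurable M" for n
      unfolding \<phi>_def by measurable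
    show "AE \<omega> in M. (\<lambda>n. \<phi> (S n \<omega>) \<omega>) \<longlonglongrightarrow> \<phi> (J \<omega>) \<omega>"
    proof (rule AE_I2)
      fix \<omega> assume \<omega>: "\<omega> \<in> space M"
      have "0 \<le> J \<omega>" by (rule LIMSEQ_le_const[OF Slim[OF \<omega>]]) (auto simp: S0)
      then have "1 + \<beta> * J \<omega> \<noteq> 0" using \<beta> by (smt (verit) mult_nonneg_nonneg)
      then show "(\<lambda>n. \<phi> (S n \<omega>) \<omega>) \<longlonglongrightarrow> \<phi> (J \<omega>) \<omega>"
        unfolding \<phi>_def by (intro tendsto_intros Slim \<omega>)
    qed
    show "AE \<omega> in M. norm (\<phi> (S n \<omega>) \<omega>) \<le> 1" for n
      using c \<beta> S0 by (intro AE_I2) (simp add: \<phi>_def)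
  qed simp
  have "(\<lambda>n. (\<integral>\<omega>. \<phi> (S n \<omega>) \<omega> \<partial>M) - lap 0 t \<beta>) \<longlonglongrightarrow> 0"
  proof (rule Lim_null_comparison)
    let ?C = "(240 * exp 6 + 62 * (1 + \<beta>^2 * exp t)) * t"
    show "\<forall>\<^sub>F n in sequentially. norm ((\<integral>\<omega>. \<phi> (S n \<omega>) \<omega> \<partial>M) - lap 0 t \<beta>) \<le> ?C * sqrt (t / real n)"
    proof (rule eventually_sequentiallyI)
      \<comment> \<open>The threshold ensures that the mesh t/n is at most 1.\<close>
      fix n assume n: "n \<ge> max 1 (nat \<lceil>t\<rceil>)"
      then have "t \<le> real n" by linarith
      with n show "norm ((\<integral>\<omega>. \<phi> (S n \<omega>) \<omega> \<partial>M) - lap 0 t \<beta>) \<le> ?C * sqrt (t / real n)"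
        using discretised_duality[OF bm \<beta> t, of n] by (simp add: \<phi>_def S_def c_def)
    qed
    have "(\<lambda>n. ?C * sqrt (t / real n)) \<longlonglongrightarrow> ?C * sqrt 0"
      by (intro tendsto_intros lim_const_over_n)
    then show "(\<lambda>n. ?C * sqrt (t / real n)) \<longlonglongrightarrow> 0" by simp
  qed
  then have "(\<lambda>n. \<integral>\<omega>. \<phi> (S n \<omega>) \<omega> \<partial>M) \<longlonglongrightarrow> lap 0 t \<beta>" by (simp add: LIM_zero_iff)
  then have "(\<integral>\<omega>. \<phi> (J \<omega>) \<omega> \<partial>M) = lap 0 t \<beta>" using lim LIMSEQ_unique by blast
  then show ?thesis by (simp add: \<phi>_def J_def c_def)
qed

end

theorem theorem2p4:
  fixes M :: "'a measure" and B :: "real \<Rightarrow> 'a \<Rightarrow> real"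
    and N :: "'b measure" and F :: "real \<Rightarrow> 'b measure" and R :: "real \<Rightarrow> 'b \<Rightarrow> real"
    and \<beta> lam t r0 :: real
  assumes "brownian_motion M B"
    and "\<beta> > 0" and "lam \<ge> 0" and "t \<ge> 0"
    and "r0 \<ge> 0" and "cosh r0 = lam / \<beta> + 1"
    and "hyp_bessel_process (-1) N F r0 R"
  shows "(\<integral>\<omega>. exp (- lam * (exp (B t \<omega> - t / 2)
                / (1 + \<beta> * integral {0..t} (\<lambda>s. exp (B s \<omega> - s / 2))))) \<partial>M)
       = (\<integral>\<omega>. exp (- \<beta> * (cosh (R t \<omega>) - 1)) \<partial>N)"
proof -
  interpret hyp_bessel_neg_one N F R r0 using assms(7) by unfold_locales
  interpret M: prob_space M using assms(1) by (simp add: brownian_motion_def)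
  have lam: "\<beta> * (cosh r0 - 1) = lam" using assms(2,6) by simp
  have rhs: "lap 0 t \<beta> = (\<integral>\<omega>. exp (- \<beta> * (cosh (R t \<omega>) - 1)) \<partial>N)" by (simp add: lap_def Y_def)
  \<comment> \<open>The grid argument needs t > 0. At t = 0 both processes sit at their
    deterministic starting points and both sides equal exp(-lam).\<close>
  show ?thesis
  proof (cases "t = 0")
    case True
    have "(\<integral>\<omega>. exp (- lam * (exp (B t \<omega> - t / 2)
        / (1 + \<beta> * integral {0..t} (\<lambda>s. exp (B s \<omega> - s / 2))))) \<partial>M) = (\<integral>\<omega>. exp (- lam) \<partial>M)"
      using assms(1) True by (intro Bochner_Integration.integral_cong) (auto simp: brownian_motion_def)
    moreover have "(\<integral>\<omega>. exp (- \<beta> * (cosh (R t \<omega>) - 1)) \<partial>N) = (\<integral>\<omega>. exp (- lam) \<partial>N)"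
      using Y_zero True lam by (intro Bochner_Integration.integral_cong) (auto simp: Y_def)
    ultimately show ?thesis by (simp add: M.prob_space prob_space)
  next
    case False
    then show ?thesis using duality[OF assms(1,2), of t] assms(4) lam rhs by (simp add: mult.assoc)
  qed
qed

end
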